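(* Let $d\ge 2$, $E=\mathbb R^d$, $\rho=d/2$, let $\lambda,\mu\in\mathbb C$ and $k\in\mathbb N$. Let $F^{(k)}_{\lambda,\mu}$ be the bidifferential operator from $\mathcal C_c^\infty(E\times E)$ to $\mathcal C_c^\infty(E)$ defined by $$F^{(k)}_{\lambda,\mu}f(x)=\big(F_{\lambda+k-1,\mu+k-1}\circ\cdots\circ F_{\lambda+1,\mu+1}\circ F_{\lambda,\mu}f\big)(x,x),$$ where $F_{\lambda,\mu}$ is the differential operator on $E\times E$ $$\begin{aligned}F_{\lambda,\mu}=\;&|y-z|^2\Delta_y\Delta_z+4(\mu+1)\sum_{j=1}^d(z_j-y_j)\frac{\partial}{\partial z_j}\Delta_y+4(\lambda+1)\sum_{j=1}^d(y_j-z_j)\frac{\partial}{\partial y_j}\Delta_z\\&+4(\mu+1)(\mu+\rho)\Delta_y+4(\lambda+1)(\lambda+\rho)\Delta_z-8(\lambda+1)(\mu+1)\sum_{j=1}^d\frac{\partial}{\partial y_j}\frac{\partial}{\partial z_j}.\end{aligned}$$ Then $F^{(k)}_{\lambda,\mu}$ is conformally covariant with respect to $(\pi_\lambda\otimes\pi_\mu,\ \pi_{\lambda+\mu+\rho+2k})$.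
   Context: $\mathbb N=\{0,1,2,\dots\}$ (for $k=0$ the composition is the identity). $G=SO_0(1,d+1)$ is the identity component of the conformal group of the sphere $S^d$, acting by (not everywhere defined) rational conformal transformations on $E$ via stereographic projection. For $g\in G$, $\kappa(g,x)>0$ is the conformal factor at $x$: $|Dg(x)\xi|=\kappa(g,x)|\xi|$ for all $\xi$. For $\lambda\in\mathbb C$, $\pi_\lambda(g)f(x)=\kappa(g^{-1},x)^{\rho+\lambda}f(g^{-1}(x))$, for $f\in\mathcal C_c^\infty(E)$ and $g$ close enough to the identity that $g$ is defined near $\mathrm{Supp}(f)$ (extended by $0$); similarly $(\pi_\lambda(g)\otimes\pi_\mu(g))f(y,z)=\kappa(g^{-1},y)^{\rho+\lambda}\kappa(g^{-1},z)^{\rho+\mu}f(g^{-1}(y),g^{-1}(z))$ for $f\in\mathcal C_c^\infty(E\times E)$. A bidifferential operator $D:\mathcal C_c^\infty(E\times E)\to\mathcal C_c^\infty(E)$ is covariant with respect to $(\pi_\lambda\otimes\pi_\mu,\pi_\nu)$ if for every $f\in\mathcal C_c^\infty(E\times E)$ and every $g$ in a small enough neighbourhood (depending on $f$) of the neutral element of $G$, $D\big((\pi_\lambda(g)\otimes\pi_\mu(g))f\big)=\pi_\nu(g)(Df)$. *)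

theory Defs
  imports "HOL-Analysis.Analysis"
begin

text \<open>
  The space \<open>E = \<real>\<^sup>d\<close> is a type \<open>'a :: euclidean_space\<close> with \<open>d = DIM('a)\<close>; the coordinates of \<open>x\<close>
  are \<open>x \<bullet> b\<close> for \<open>b \<in> Basis\<close>.
\<close>

definition rho :: "'a::euclidean_space itself \<Rightarrow> complex" where
  "rho _ = of_nat DIM('a) / 2"


subsection \<open>Smooth functions, test functions and partial derivatives\<close>

definition dir_deriv :: "'b::real_normed_vector \<Rightarrow> ('b \<Rightarrow> 'c::real_normed_vector) \<Rightarrow> 'b \<Rightarrow> 'c" where
  "dir_deriv v f = (\<lambda>x. frechet_derivative f (at x) v)"

primrec C_times :: "nat \<Rightarrow> ('b::real_normed_vector \<Rightarrow> 'c::real_normed_vector) \<Rightarrow> bool" where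
  "C_times 0 f \<longleftrightarrow> continuous_on UNIV f"
| "C_times (Suc n) f \<longleftrightarrow> (\<forall>x. f differentiable (at x)) \<and> (\<forall>v. C_times n (dir_deriv v f))"

definition smooth :: "('b::real_normed_vector \<Rightarrow> 'c::real_normed_vector) \<Rightarrow> bool" where
  "smooth f \<longleftrightarrow> (\<forall>n. C_times n f)"

definition test_functions :: "('b::euclidean_space \<Rightarrow> complex) set" where
  "test_functions = {f. smooth f \<and> compact (closure {x. f x \<noteq> 0})}"

text \<open>Points of \<open>E \<times> E\<close> are written \<open>(y, z)\<close>; \<open>d_y b\<close> is the partial derivative with respect to
  the coordinate \<open>y \<bullet> b\<close>, and similarly for \<open>z\<close>.\<close>

definition d_y :: "'a::euclidean_space \<Rightarrow> ('a \<times> 'a \<Rightarrow> complex) \<Rightarrow> 'a \<times> 'a \<Rightarrow> complex" where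
  "d_y b = dir_deriv (b, 0)"

definition d_z :: "'a::euclidean_space \<Rightarrow> ('a \<times> 'a \<Rightarrow> complex) \<Rightarrow> 'a \<times> 'a \<Rightarrow> complex" where
  "d_z b = dir_deriv (0, b)"

definition laplace_y :: "('a::euclidean_space \<times> 'a \<Rightarrow> complex) \<Rightarrow> 'a \<times> 'a \<Rightarrow> complex" where
  "laplace_y f = (\<lambda>p. \<Sum>b\<in>Basis. d_y b (d_y b f) p)"

definition laplace_z :: "('a::euclidean_space \<times> 'a \<Rightarrow> complex) \<Rightarrow> 'a \<times> 'a \<Rightarrow> complex" where
  "laplace_z f = (\<lambda>p. \<Sum>b\<in>Basis. d_z b (d_z b f) p)"


subsection \<open>Bidifferential operators\<close>

text \<open>
  A bidifferential operator is a differential operator on \<open>E \<times> E\<close> followed by restriction to the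
  diagonal. A list of basis vectors of \<open>E \<times> E\<close> encodes an iterated partial derivative.
\<close>

definition bidifferential_operator ::
    "(('a::euclidean_space \<times> 'a \<Rightarrow> complex) \<Rightarrow> 'a \<Rightarrow> complex) \<Rightarrow> bool" where
  "bidifferential_operator D \<longleftrightarrow>
    (\<exists>S (a :: ('a \<times> 'a) list \<Rightarrow> 'a \<Rightarrow> complex).
       finite S \<and> S \<subseteq> lists Basis \<and> (\<forall>vs\<in>S. smooth (a vs)) \<and>
       (\<forall>f\<in>test_functions. \<forall>x. D f x = (\<Sum>vs\<in>S. a vs x * foldr dir_deriv vs f (x, x))))"

definition F_op :: "complex \<Rightarrow> complex \<Rightarrow> ('a::euclidean_space \<times> 'a \<Rightarrow> complex) \<Rightarrow> 'a \<times> 'a \<Rightarrow> complex" where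
  "F_op lam mu f = (\<lambda>(y, z).
      of_real ((norm (y - z))\<^sup>2) * laplace_y (laplace_z f) (y, z)
    + 4 * (mu + 1) * (\<Sum>b\<in>Basis. of_real (z \<bullet> b - y \<bullet> b) * d_z b (laplace_y f) (y, z))
    + 4 * (lam + 1) * (\<Sum>b\<in>Basis. of_real (y \<bullet> b - z \<bullet> b) * d_y b (laplace_z f) (y, z))
    + 4 * (mu + 1) * (mu + rho TYPE('a)) * laplace_y f (y, z)
    + 4 * (lam + 1) * (lam + rho TYPE('a)) * laplace_z f (y, z)
    - 8 * (lam + 1) * (mu + 1) * (\<Sum>b\<in>Basis. d_y b (d_z b f) (y, z)))"

primrec F_comp ::
    "complex \<Rightarrow> complex \<Rightarrow> nat \<Rightarrow> ('a::euclidean_space \<times> 'a \<Rightarrow> complex) \<Rightarrow> 'a \<times> 'a \<Rightarrow> complex" where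
  "F_comp lam mu 0 f = f"
| "F_comp lam mu (Suc k) f = F_op (lam + of_nat k) (mu + of_nat k) (F_comp lam mu k f)"

definition F_bidiff ::
    "complex \<Rightarrow> complex \<Rightarrow> nat \<Rightarrow> ('a::euclidean_space \<times> 'a \<Rightarrow> complex) \<Rightarrow> 'a \<Rightarrow> complex" where
  "F_bidiff lam mu k f = (\<lambda>x. F_comp lam mu k f (x, x))"


subsection \<open>The conformal group and its rational action\<close>

text \<open>\<open>\<real>\<^bsup>1,d+1\<^esup>\<close> is \<open>\<real> \<times> (E \<times> \<real>)\<close>, and the unit sphere \<open>S\<^sup>d\<close> lies in the second factor.\<close>

type_synonym 'a lorentz = "real \<times> ('a \<times> real)"

definition lorentz_form :: "'a::euclidean_space lorentz \<Rightarrow> real" where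
  "lorentz_form v = (fst v)\<^sup>2 - (norm (snd v))\<^sup>2"

definition lorentz_group :: "('a::euclidean_space lorentz \<Rightarrow>\<^sub>L 'a lorentz) set" where
  "lorentz_group = {g. \<forall>v. lorentz_form (blinfun_apply g v) = lorentz_form v}"

text \<open>\<open>SO\<^sub>0(1,d+1)\<close>: the groups \<open>O(1,d+1)\<close> and \<open>SO(1,d+1)\<close> have the same identity component, since the
  determinant is continuous with values in \<open>{-1, 1}\<close> on \<open>O(1,d+1)\<close>.\<close>

definition conformal_group :: "('a::euclidean_space lorentz \<Rightarrow>\<^sub>L 'a lorentz) set" where
  "conformal_group = connected_component_set lorentz_group id_blinfun"

text \<open>The sphere is the projectivised light cone: \<open>g\<close> sends \<open>u\<close> to \<open>u'\<close> where \<open>g (1, u)\<close> is a multiple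
  of \<open>(1, u')\<close>. Linear maps are taken as plain functions here, so that \<open>g\<^sup>-\<^sup>1\<close> can be written \<open>inv g\<close>.\<close>

definition sphere_act :: "('a::euclidean_space lorentz \<Rightarrow> 'a lorentz) \<Rightarrow> 'a \<times> real \<Rightarrow> 'a \<times> real" where
  "sphere_act g u = snd (g (1, u)) /\<^sub>R fst (g (1, u))"

text \<open>Stereographic projection from the pole \<open>(0, -1)\<close> and its inverse.\<close>

definition stereo :: "'a::euclidean_space \<times> real \<Rightarrow> 'a" where
  "stereo u = fst u /\<^sub>R (1 + snd u)"

definition stereo_inv :: "'a::euclidean_space \<Rightarrow> 'a \<times> real" where
  "stereo_inv x = ((2 / (1 + (norm x)\<^sup>2)) *\<^sub>R x, (1 - (norm x)\<^sup>2) / (1 + (norm x)\<^sup>2))"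

definition act_defined :: "('a::euclidean_space lorentz \<Rightarrow> 'a lorentz) \<Rightarrow> 'a \<Rightarrow> bool" where
  "act_defined g x \<longleftrightarrow> sphere_act g (stereo_inv x) \<noteq> (0, -1)"

definition act :: "('a::euclidean_space lorentz \<Rightarrow> 'a lorentz) \<Rightarrow> 'a \<Rightarrow> 'a" where
  "act g x = stereo (sphere_act g (stereo_inv x))"

definition kappa :: "('a::euclidean_space lorentz \<Rightarrow> 'a lorentz) \<Rightarrow> 'a \<Rightarrow> real" where
  "kappa g x = (THE c. c > 0 \<and> (\<forall>\<xi>. norm (frechet_derivative (act g) (at x) \<xi>) = c * norm \<xi>))"


subsection \<open>The representations and covariance\<close>

text \<open>
  If \<open>g\<close> is defined on the support of \<open>f\<close>, then \<open>f (g\<^sup>-\<^sup>1 x)\<close> vanishes off the compact set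
  \<open>g (Supp f)\<close> wherever \<open>g\<^sup>-\<^sup>1\<close> is defined, so the functions below are the usual ones extended by \<open>0\<close>.
  For other \<open>g\<close> their values are of no significance: covariance only concerns \<open>g\<close> in a small enough
  neighbourhood of the identity, which depends on \<open>f\<close>.
\<close>

definition pi_rep ::
    "complex \<Rightarrow> ('a::euclidean_space lorentz \<Rightarrow>\<^sub>L 'a lorentz) \<Rightarrow> ('a \<Rightarrow> complex) \<Rightarrow> 'a \<Rightarrow> complex" where
  "pi_rep lam g f = (let h = inv (blinfun_apply g) in
     (\<lambda>x. if act_defined h x
          then of_real (kappa h x) powr (rho TYPE('a) + lam) * f (act h x)
          else 0))"

definition pi_tensor ::
    "complex \<Rightarrow> complex \<Rightarrow> ('a::euclidean_space lorentz \<Rightarrow>\<^sub>L 'a lorentz) \<Rightarrow>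
     ('a \<times> 'a \<Rightarrow> complex) \<Rightarrow> 'a \<times> 'a \<Rightarrow> complex" where
  "pi_tensor lam mu g f = (let h = inv (blinfun_apply g) in
     (\<lambda>(y, z). if act_defined h y \<and> act_defined h z
          then of_real (kappa h y) powr (rho TYPE('a) + lam) *
               of_real (kappa h z) powr (rho TYPE('a) + mu) * f (act h y, act h z)
          else 0))"

definition covariant_bidifferential ::
    "complex \<Rightarrow> complex \<Rightarrow> complex \<Rightarrow> (('a::euclidean_space \<times> 'a \<Rightarrow> complex) \<Rightarrow> 'a \<Rightarrow> complex) \<Rightarrow> bool" where
  "covariant_bidifferential lam mu nu D \<longleftrightarrow>
     bidifferential_operator D \<and>
     (\<forall>f\<in>test_functions. \<exists>U. open U \<and> id_blinfun \<in> U \<and>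
        (\<forall>g\<in>conformal_group \<inter> U. D (pi_tensor lam mu g f) = pi_rep nu g (D f)))"

end

theory Submission
  imports Defs
begin

text \<open>
  The theorem holds because \<open>F\<close> is a contraction of two simpler covariant operators, one in \<open>y\<close> and one
  in \<open>z\<close>, and this becomes visible in the Lorentz space \<open>\<real>\<^bsup>1,d+1\<^esup>\<close> with form \<open>\<langle>v,w\<rangle>\<close>. Embed \<open>E\<close> in the
  light cone by \<open>\<xi>(x) = (1 + |x|\<^sup>2, 2x, 1 - |x|\<^sup>2)\<close>, so that \<open>\<langle>\<xi>(y), \<xi>(z)\<rangle> = 2|y - z|\<^sup>2\<close>, and put
  \<open>\<eta> = (1, 0, -1)\<close>. A Lorentz map \<open>h\<close> acts on \<open>E\<close> by \<open>h \<xi>(x) = c(x) \<xi>(h(x))\<close>, and differentiating this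
  relation shows \<open>\<kappa>(h,x) = 1/c(x)\<close> (\<open>kappa_eq\<close>).

  For \<open>s = \<rho> + \<lambda>\<close> and a Lorentz vector \<open>N\<close> consider the second order operator
  \<open>D\<^sub>N u = \<langle>N,\<xi>\<rangle> \<Delta>u + 2(\<lambda>+1) \<Sum>\<^sub>b \<langle>N,\<partial>\<^sub>b\<xi>\<rangle> \<partial>\<^sub>bu + 4(\<lambda>+1)s \<langle>N,\<eta>\<rangle> u\<close>,
  the component along \<open>N\<close> of the tractor D operator (Thomas operator) of conformal geometry. If \<open>U\<close> is a
  function on an open cone that contains all \<open>\<xi>(x)\<close>, homogeneous of degree \<open>-s\<close>, then Euler's relation
  gives (\<open>tractor_D_ambient\<close>)
  \<open>D\<^sub>N(U \<circ> \<xi>) = -4 \<langle>N,\<xi>\<rangle> (\<box>U) \<circ> \<xi> - 8(\<lambda>+1) (\<partial>\<^sub>NU) \<circ> \<xi>\<close>,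
  where \<open>\<box>\<close> is the wave operator. The right-hand side commutes with Lorentz maps, and every smooth \<open>u\<close>
  has such an extension \<open>U\<close>. As \<open>(U \<circ> h) \<circ> \<xi>\<close> is the transform \<open>\<kappa>\<^sup>s (u \<circ> h)\<close> of \<open>u\<close>, this yields
  \<open>D\<^sub>N(\<kappa>\<^sup>s (u \<circ> h)) = \<kappa>\<^bsup>s+1\<^esup> (D\<^bsub>hN\<^esub>u) \<circ> h\<close> (\<open>tractor_D_covariant\<close>).

  Let \<open>A\<close> run through the standard basis and let \<open>\<epsilon>\<^sub>A = \<langle>A,A\<rangle>\<close>. Since the tensor \<open>\<Sum>\<^sub>A \<epsilon>\<^sub>A A \<otimes> A\<close> is Lorentz
  invariant, the sum over \<open>A\<close> of \<open>\<epsilon>\<^sub>A\<close> times the product of \<open>D\<^sub>A\<close> acting in \<open>y\<close> and \<open>D\<^sub>A\<close> acting in \<open>z\<close> is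
  covariant and raises both weights by one. Expanding the scalar products of \<open>\<xi>\<close>, \<open>\<partial>\<^sub>b\<xi>\<close> and \<open>\<eta>\<close> at \<open>y\<close> and \<open>z\<close> identifies this operator
  as \<open>2 F\<close> (\<open>F_op_eq_contraction\<close>). Iterating \<open>F\<close> raises both weights by \<open>k\<close> (\<open>F_comp_covariant\<close>), and
  on the diagonal the two powers of \<open>\<kappa>\<close> multiply to the exponent \<open>2\<rho> + \<lambda> + \<mu> + 2k\<close> of the target
  representation.

  Two matters of domain remain. The neighbourhood of the identity has to keep the forward light
  cone forward, which makes \<open>c \<ge> 0\<close> on all of \<open>E\<close>. Where \<open>c(x) = 0\<close>, the point \<open>x\<close> is sent to
  infinity, and the transform of a compactly supported function vanishes near it
  (\<open>pi_tensor_vanishes_at_singularity\<close>), so that both sides are \<open>0\<close> there.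
\<close>

section \<open>Calculus of smooth functions on open sets\<close>

text \<open>
  The local version of \<open>C_times\<close>: the transformed functions are smooth only where the
  transformation is defined.
\<close>

primrec C_on :: "nat \<Rightarrow> 'b::real_normed_vector set \<Rightarrow> ('b \<Rightarrow> 'c::real_normed_vector) \<Rightarrow> bool" where
  "C_on 0 S f \<longleftrightarrow> continuous_on S f"
| "C_on (Suc n) S f \<longleftrightarrow> (\<forall>x\<in>S. f differentiable (at x)) \<and> (\<forall>v. C_on n S (dir_deriv v f))"

definition smooth_on :: "'b::real_normed_vector set \<Rightarrow> ('b \<Rightarrow> 'c::real_normed_vector) \<Rightarrow> bool" where
  "smooth_on S f \<longleftrightarrow> (\<forall>n. C_on n S f)"

lemma C_on_UNIV: "C_on n UNIV f \<longleftrightarrow> C_times n f"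
  by (induction n arbitrary: f) auto

lemma smooth_on_UNIV: "smooth_on UNIV f \<longleftrightarrow> smooth f"
  by (simp add: smooth_on_def smooth_def C_on_UNIV)

lemma dir_derivI: "(f has_derivative f') (at x) \<Longrightarrow> dir_deriv v f x = f' v"
  unfolding dir_deriv_def using frechet_derivative_at by metis

lemma has_derivative_dir_deriv:
  "f differentiable (at x) \<Longrightarrow> (f has_derivative (\<lambda>v. dir_deriv v f x)) (at x)"
  unfolding dir_deriv_def using frechet_derivative_works by blast

lemma linear_dir_deriv: "f differentiable (at x) \<Longrightarrow> linear (\<lambda>v. dir_deriv v f x)"
  unfolding dir_deriv_def using linear_frechet_derivative by auto

text \<open>
  The Frechet derivative is chosen among all candidates, and the set of candidates depends on the
  germ alone; so the chosen values agree whether or not a candidate exists.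
\<close>

lemma dir_deriv_cong_open:
  assumes "open S" "x \<in> S" "\<And>y. y \<in> S \<Longrightarrow> f y = g y"
  shows "dir_deriv v f x = dir_deriv v g x"
proof -
  have "(f has_derivative F) (at x) \<longleftrightarrow> (g has_derivative F) (at x)" for F
    using assms has_derivative_transform_within_open[of f F x UNIV S g]
      has_derivative_transform_within_open[of g F x UNIV S f] by auto
  then show ?thesis
    unfolding dir_deriv_def frechet_derivative_def by simp
qed

lemma C_on_cong:
  assumes "open S" "\<And>y. y \<in> S \<Longrightarrow> f y = g y" "C_on n S f"
  shows "C_on n S g"
  using assms(2,3)
proof (induction n arbitrary: f g)
  case 0
  then show ?case by (metis C_on.simps(1) continuous_on_cong)
next
  case (Suc n)
  have d: "(g has_derivative (\<lambda>v. dir_deriv v f x)) (at x)" if "x \<in> S" for x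
  proof (rule has_derivative_transform_within_open)
    show "(f has_derivative (\<lambda>v. dir_deriv v f x)) (at x)"
      using Suc.prems(2) that by (simp add: has_derivative_dir_deriv)
  qed (use assms(1) that Suc.prems(1) in auto)
  have "C_on n S (dir_deriv v g)" for v
  proof (rule Suc.IH)
    show "dir_deriv v f y = dir_deriv v g y" if "y \<in> S" for y
      using dir_derivI[OF d[OF that]] by simp
    show "C_on n S (dir_deriv v f)" using Suc.prems(2) by simp
  qed
  then show ?case using d unfolding C_on.simps differentiable_def by blast
qed

text \<open>
  The induction step in a form that needs a derivative up to equality on \<open>S\<close> only; \<open>dir_deriv\<close> is
  replaced by an explicit formula \<open>g\<close>.
\<close>

lemma C_on_SucI:
  assumes "open S" "\<And>x. x \<in> S \<Longrightarrow> (f has_derivative (\<lambda>v. g v x)) (at x)" "\<And>v. C_on n S (g v)"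
  shows "C_on (Suc n) S f"
proof -
  have "C_on n S (dir_deriv v f)" for v
    by (rule C_on_cong[OF assms(1) _ assms(3)[of v]]) (simp add: dir_derivI[OF assms(2)])
  then show ?thesis using assms(2) unfolding C_on.simps differentiable_def by blast
qed

lemma C_on_Suc_derivative:
  "C_on (Suc n) S f \<Longrightarrow> x \<in> S \<Longrightarrow> (f has_derivative (\<lambda>v. dir_deriv v f x)) (at x)"
  by (simp add: has_derivative_dir_deriv)

lemma dir_deriv_const [simp]: "dir_deriv v (\<lambda>x. c) = (\<lambda>x. 0)"
  by (rule ext) (rule dir_derivI[OF has_derivative_const])

lemma C_on_const [simp]: "C_on n S (\<lambda>x. c)"
proof (induction n arbitrary: c)
  case (Suc n)
  then show ?case by simp
qed simp

lemma C_on_subset: "C_on n S f \<Longrightarrow> T \<subseteq> S \<Longrightarrow> C_on n T f"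
  by (induction n arbitrary: f) (auto intro: continuous_on_subset)

lemma C_on_SucD: "C_on (Suc n) S f \<Longrightarrow> C_on n S f"
  by (induction n arbitrary: f)
    (auto intro!: continuous_at_imp_continuous_on differentiable_imp_continuous_within)

lemma smooth_on_differentiable: "smooth_on S f \<Longrightarrow> x \<in> S \<Longrightarrow> f differentiable (at x)"
  unfolding smooth_on_def using C_on.simps(2) by blast

lemma smooth_on_dir_deriv: "smooth_on S f \<Longrightarrow> smooth_on S (dir_deriv v f)"
  unfolding smooth_on_def by (metis C_on.simps(2))

lemma smooth_on_continuous: "smooth_on S f \<Longrightarrow> continuous_on S f"
  unfolding smooth_on_def using C_on.simps(1) by blast

lemma smooth_on_const [simp]: "smooth_on S (\<lambda>x. c)"
  by (simp add: smooth_on_def)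

lemma dir_deriv_linear_apply:
  assumes "bounded_linear L" "f differentiable (at x)"
  shows "dir_deriv v (\<lambda>x. L (f x)) x = L (dir_deriv v f x)"
  by (rule dir_derivI[OF bounded_linear.has_derivative[OF assms(1) has_derivative_dir_deriv[OF assms(2)]]])

lemma smooth_on_linear_apply:
  assumes S: "open S" and L: "bounded_linear L" and f: "smooth_on S f"
  shows "smooth_on S (\<lambda>x. L (f x))"
proof -
  have "C_on n S (\<lambda>x. L (f x))" if "C_on n S f" for n
    using that
  proof (induction n arbitrary: f)
    case 0
    then show ?case by (simp add: L bounded_linear.continuous_on)
  next
    case (Suc n)
    show ?case
    proof (rule C_on_SucI[OF S])
      show "((\<lambda>x. L (f x)) has_derivative (\<lambda>v. L (dir_deriv v f x))) (at x)" if "x \<in> S" for x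
        using bounded_linear.has_derivative[OF L C_on_Suc_derivative[OF Suc.prems that]] .
      show "C_on n S (\<lambda>x. L (dir_deriv v f x))" for v
        using Suc by simp
    qed
  qed
  then show ?thesis using f by (simp add: smooth_on_def)
qed

lemma smooth_on_bounded_linear:
  assumes "bounded_linear L" shows "smooth_on S L"
proof -
  have d: "(L has_derivative L) (at x)" for x
    using assms bounded_linear_imp_has_derivative by blast
  then have "dir_deriv v L = (\<lambda>x. L v)" for v
    using dir_derivI by fastforce
  then have "C_on (Suc n) S L" for n
    using d unfolding C_on.simps differentiable_def by (metis C_on_const)
  then show ?thesis
    unfolding smooth_on_def using C_on_SucD by blast
qed

lemma dir_deriv_bilinear:
  assumes "bounded_bilinear B" "f differentiable (at x)" "g differentiable (at x)"
  shows "dir_deriv v (\<lambda>x. B (f x) (g x)) x = B (f x) (dir_deriv v g x) + B (dir_deriv v f x) (g x)"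
  by (rule dir_derivI[OF bounded_bilinear.FDERIV[OF assms(1)
        has_derivative_dir_deriv[OF assms(2)] has_derivative_dir_deriv[OF assms(3)]]])

lemma dir_deriv_add:
  assumes "f differentiable (at x)" "g differentiable (at x)"
  shows "dir_deriv v (\<lambda>x. f x + g x) x = dir_deriv v f x + dir_deriv v g x"
  by (rule dir_derivI[OF has_derivative_add[OF has_derivative_dir_deriv[OF assms(1)]
        has_derivative_dir_deriv[OF assms(2)]]])

lemma C_on_add:
  assumes S: "open S"
  shows "C_on n S f \<Longrightarrow> C_on n S g \<Longrightarrow> C_on n S (\<lambda>x. f x + g x)"
proof (induction n arbitrary: f g)
  case 0
  then show ?case by (simp add: continuous_on_add)
next
  case (Suc n)
  show ?case
  proof (rule C_on_SucI[OF S])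
    show "((\<lambda>x. f x + g x) has_derivative (\<lambda>v. dir_deriv v f x + dir_deriv v g x)) (at x)"
      if "x \<in> S" for x
      using has_derivative_add[OF Suc.prems[THEN C_on_Suc_derivative, OF that]] .
    show "C_on n S (\<lambda>x. dir_deriv v f x + dir_deriv v g x)" for v
      using Suc by simp
  qed
qed

lemma C_on_bilinear:
  assumes S: "open S" and B: "bounded_bilinear B"
  shows "C_on n S f \<Longrightarrow> C_on n S g \<Longrightarrow> C_on n S (\<lambda>x. B (f x) (g x))"
proof (induction n arbitrary: f g)
  case 0
  then show ?case by (simp add: bounded_bilinear.continuous_on[OF B])
next
  case (Suc n)
  show ?case
  proof (rule C_on_SucI[OF S])
    show "((\<lambda>x. B (f x) (g x)) has_derivative
        (\<lambda>v. B (f x) (dir_deriv v g x) + B (dir_deriv v f x) (g x))) (at x)" if "x \<in> S" for x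
      using bounded_bilinear.FDERIV[OF B Suc.prems[THEN C_on_Suc_derivative, OF that]] .
    have "C_on n S f" "C_on n S g" using Suc.prems C_on_SucD by blast+
    then show "C_on n S (\<lambda>x. B (f x) (dir_deriv v g x) + B (dir_deriv v f x) (g x))" for v
      using Suc.prems by (intro C_on_add[OF S] Suc.IH) simp_all
  qed
qed

lemma smooth_on_add: "open S \<Longrightarrow> smooth_on S f \<Longrightarrow> smooth_on S g \<Longrightarrow> smooth_on S (\<lambda>x. f x + g x)"
  unfolding smooth_on_def using C_on_add by blast

lemma smooth_on_bilinear:
  "open S \<Longrightarrow> bounded_bilinear B \<Longrightarrow> smooth_on S f \<Longrightarrow> smooth_on S g \<Longrightarrow> smooth_on S (\<lambda>x. B (f x) (g x))"
  unfolding smooth_on_def using C_on_bilinear by blast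

lemmas smooth_on_mult = smooth_on_bilinear[OF _ bounded_bilinear_mult]
lemmas smooth_on_scaleR = smooth_on_bilinear[OF _ bounded_bilinear_scaleR]
lemmas smooth_on_inner = smooth_on_bilinear[OF _ bounded_bilinear_inner]
lemmas smooth_on_of_real = smooth_on_linear_apply[OF _ bounded_linear_of_real]

lemma smooth_on_uminus: "open S \<Longrightarrow> smooth_on S f \<Longrightarrow> smooth_on S (\<lambda>x. - f x)"
  using smooth_on_linear_apply[OF _ bounded_linear_minus[OF bounded_linear_ident]] by blast

lemma smooth_on_diff: "open S \<Longrightarrow> smooth_on S f \<Longrightarrow> smooth_on S g \<Longrightarrow> smooth_on S (\<lambda>x. f x - g x)"
  using smooth_on_add[OF _ _ smooth_on_uminus, of S f g] by simp

lemma smooth_on_sum: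
  assumes "open S" "\<And>i. i \<in> I \<Longrightarrow> smooth_on S (f i)"
  shows "smooth_on S (\<lambda>x. \<Sum>i\<in>I. f i x)"
  using assms(2) by (induction I rule: infinite_finite_induct) (auto intro!: smooth_on_add assms(1))

lemma dir_deriv_compose:
  assumes "\<phi> differentiable (at x)" "f differentiable (at (\<phi> x))"
  shows "dir_deriv v (\<lambda>x. f (\<phi> x)) x = dir_deriv (dir_deriv v \<phi> x) f (\<phi> x)"
    and "(\<lambda>x. f (\<phi> x)) differentiable (at x)"
proof -
  note d = has_derivative_compose[OF has_derivative_dir_deriv[OF assms(1)] has_derivative_dir_deriv[OF assms(2)]]
  show "dir_deriv v (\<lambda>x. f (\<phi> x)) x = dir_deriv (dir_deriv v \<phi> x) f (\<phi> x)"
    by (rule dir_derivI[OF d])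
  show "(\<lambda>x. f (\<phi> x)) differentiable (at x)"
    using d unfolding differentiable_def by blast
qed

lemma dir_deriv_basis_expansion:
  fixes f :: "'m::euclidean_space \<Rightarrow> 'c::real_normed_vector"
  assumes "f differentiable (at p)"
  shows "dir_deriv w f p = (\<Sum>b\<in>Basis. (w \<bullet> b) *\<^sub>R dir_deriv b f p)"
proof -
  have "dir_deriv w f p = dir_deriv (\<Sum>b\<in>Basis. (w \<bullet> b) *\<^sub>R b) f p"
    by (simp add: euclidean_representation)
  also have "\<dots> = (\<Sum>b\<in>Basis. (w \<bullet> b) *\<^sub>R dir_deriv b f p)"
    using linear_sum[OF linear_dir_deriv[OF assms], of "\<lambda>b. (w \<bullet> b) *\<^sub>R b" Basis]
      linear_scale[OF linear_dir_deriv[OF assms]] by simp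
  finally show ?thesis .
qed

text \<open>
  By the chain rule, a directional derivative of \<open>f \<circ> \<phi>\<close> is a sum of products of smooth functions with
  partial derivatives of \<open>f\<close> composed with \<open>\<phi>\<close>; so the order of \<open>f\<close> can be lowered by one.
\<close>

lemma smooth_on_compose:
  fixes \<phi> :: "'b::real_normed_vector \<Rightarrow> 'm::euclidean_space"
  assumes S: "open S" and T: "open T" and \<phi>: "smooth_on S \<phi>" and sub: "\<phi> ` S \<subseteq> T"
    and f: "smooth_on T f"
  shows "smooth_on S (\<lambda>x. f (\<phi> x))"
proof -
  have "C_on n S (\<lambda>x. f (\<phi> x))" if "C_on n T f" for n
    using that
  proof (induction n arbitrary: f)
    case 0
    then show ?case
      using smooth_on_continuous[OF \<phi>] continuous_on_compose2 sub by (metis C_on.simps(1))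
  next
    case (Suc n)
    have d: "\<phi> differentiable (at x)" "f differentiable (at (\<phi> x))" if "x \<in> S" for x
      using that smooth_on_differentiable[OF \<phi>] Suc.prems sub by auto
    show ?case
    proof (rule C_on_SucI[OF S])
      show "((\<lambda>x. f (\<phi> x)) has_derivative
          (\<lambda>v. \<Sum>b\<in>Basis. (dir_deriv v \<phi> x \<bullet> b) *\<^sub>R dir_deriv b f (\<phi> x))) (at x)" if "x \<in> S" for x
      proof -
        have "dir_deriv (dir_deriv v \<phi> x) f (\<phi> x)
            = (\<Sum>b\<in>Basis. (dir_deriv v \<phi> x \<bullet> b) *\<^sub>R dir_deriv b f (\<phi> x))" for v
          by (rule dir_deriv_basis_expansion[OF d(2)[OF that]])
        then show ?thesis
          using has_derivative_compose[OF d[OF that, THEN has_derivative_dir_deriv]] by simp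
      qed
      have "C_on n S (\<lambda>x. \<Sum>b\<in>B. (dir_deriv v \<phi> x \<bullet> b) *\<^sub>R dir_deriv b f (\<phi> x))"
        if "finite B" for v B
        using that
      proof (induction B)
        case (insert b B)
        have "smooth_on S (\<lambda>x. dir_deriv v \<phi> x \<bullet> b)"
          using smooth_on_dir_deriv[OF \<phi>] smooth_on_const S by (intro smooth_on_inner)
        then have "C_on n S (\<lambda>x. dir_deriv v \<phi> x \<bullet> b)" by (simp add: smooth_on_def)
        moreover have "C_on n S (\<lambda>x. dir_deriv b f (\<phi> x))"
          using Suc by auto
        ultimately show ?case
          using insert by (simp add: C_on_add[OF S] C_on_bilinear[OF S bounded_bilinear_scaleR])
      qed simp
      then show "C_on n S (\<lambda>x. \<Sum>b\<in>Basis. (dir_deriv v \<phi> x \<bullet> b) *\<^sub>R dir_deriv b f (\<phi> x))" for v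
        by simp
    qed
  qed
  then show ?thesis using f by (simp add: smooth_on_def)
qed

lemma smooth_on_inverse_pos: "smooth_on {0<..} (inverse :: real \<Rightarrow> real)"
proof -
  have d: "(inverse has_derivative (\<lambda>v. - (inverse t * v * inverse t))) (at t)" if "t \<in> {0<..}" for t :: real
    using that has_derivative_inverse'[of t UNIV] by auto
  have o: "open {0::real<..}" by simp
  have "C_on n {0<..} (inverse :: real \<Rightarrow> real)" for n
  proof (induction n)
    case 0
    then show ?case by (auto intro!: continuous_intros)
  next
    case (Suc n)
    have "C_on n {0<..} (\<lambda>t. (- v) * (inverse t * inverse t))" for v :: real
      using Suc by (intro C_on_bilinear[OF o bounded_bilinear_mult]) simp_all
    then show ?case using d by (intro C_on_SucI[OF o]) (simp_all add: mult_ac)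
  qed
  then show ?thesis by (simp add: smooth_on_def)
qed

lemma has_derivative_powr_pos:
  fixes t :: real
  assumes "t > 0"
  shows "((\<lambda>t. complex_of_real t powr s) has_derivative
    (\<lambda>v. of_real v * (s * complex_of_real t powr (s - 1)))) (at t)"
proof -
  have "((\<lambda>t. complex_of_real t powr s) has_vector_derivative (1 * (s * complex_of_real t powr (s - 1)))) (at t)"
    using assms by (intro has_vector_derivative_real_field has_field_derivative_powr)
      (auto simp: complex_nonpos_Reals_iff intro!: derivative_eq_intros)
  then show ?thesis by (simp add: has_vector_derivative_def scaleR_conv_of_real)
qed

lemma smooth_on_powr_pos: "smooth_on {0<..} (\<lambda>t::real. complex_of_real t powr s)"
proof -
  have "C_on n {0<..} (\<lambda>t::real. complex_of_real t powr s)" for n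
  proof (induction n arbitrary: s)
    case 0
    show ?case
      using has_derivative_powr_pos
      by (auto intro!: continuous_at_imp_continuous_on has_derivative_continuous)
  next
    case (Suc n)
    have o: "open {0::real<..}" by simp
    have "C_on n {0<..} (\<lambda>t. of_real v * (s * complex_of_real t powr (s - 1)))" for v :: real
      using Suc by (intro C_on_bilinear[OF o bounded_bilinear_mult] C_on_const) simp_all
    then show ?case using has_derivative_powr_pos by (intro C_on_SucI[OF o]) simp_all
  qed
  then show ?thesis by (simp add: smooth_on_def)
qed

subsection \<open>Symmetry of second derivatives\<close>

text \<open>
  The second difference over the parallelogram spanned by \<open>h v\<close> and \<open>h w\<close> is \<open>h\<^sup>2\<close> times a mixed second
  derivative at some point of it: apply the mean value theorem along \<open>v\<close> to the increments along
  \<open>w\<close>, and then along \<open>w\<close> to the derivative.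
\<close>

lemma real_double_mvt:
  fixes f :: "'b::real_normed_vector \<Rightarrow> real"
  assumes sm: "smooth_on S f" and h: "h > 0"
    and sub: "\<And>s t. 0 \<le> s \<Longrightarrow> s \<le> h \<Longrightarrow> 0 \<le> t \<Longrightarrow> t \<le> h \<Longrightarrow> x + s *\<^sub>R v + t *\<^sub>R w \<in> S"
  shows "\<exists>s t. 0 \<le> s \<and> s \<le> h \<and> 0 \<le> t \<and> t \<le> h \<and>
     f (x + h *\<^sub>R v + h *\<^sub>R w) - f (x + h *\<^sub>R v) - f (x + h *\<^sub>R w) + f x
     = h * h * dir_deriv w (dir_deriv v f) (x + s *\<^sub>R v + t *\<^sub>R w)"
proof -
  have line: "((\<lambda>r. g (p + r *\<^sub>R u)) has_real_derivative dir_deriv u g (p + r *\<^sub>R u)) (at r)"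
    if "g differentiable (at (p + r *\<^sub>R u))" for g :: "'b \<Rightarrow> real" and p u r
  proof -
    have "((\<lambda>r. p + r *\<^sub>R u) has_derivative (\<lambda>t. t *\<^sub>R u)) (at r)"
      by (auto intro!: derivative_eq_intros)
    from has_derivative_compose[OF this has_derivative_dir_deriv[OF that]]
    have "((\<lambda>r. g (p + r *\<^sub>R u)) has_derivative (\<lambda>t. dir_deriv (t *\<^sub>R u) g (p + r *\<^sub>R u))) (at r)" .
    moreover have "dir_deriv (t *\<^sub>R u) g (p + r *\<^sub>R u) = dir_deriv u g (p + r *\<^sub>R u) * t" for t
      using linear_scale[OF linear_dir_deriv[OF that]] by simp
    ultimately show ?thesis by (simp add: has_field_derivative_def)
  qed
  define G where "G s = f (x + h *\<^sub>R w + s *\<^sub>R v) - f (x + s *\<^sub>R v)" for s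
  define G' where "G' s = dir_deriv v f (x + h *\<^sub>R w + s *\<^sub>R v) - dir_deriv v f (x + s *\<^sub>R v)" for s
  have "(G has_real_derivative G' s) (at s)" if "0 \<le> s" "s \<le> h" for s
    unfolding G_def G'_def using that sub[of s h] sub[of s 0] h
    by (intro DERIV_diff line smooth_on_differentiable[OF sm]) (auto simp: algebra_simps)
  from MVT2[OF h this] obtain s where s: "0 < s" "s < h" "G h - G 0 = h * G' s" by auto
  define H where "H t = dir_deriv v f (x + s *\<^sub>R v + t *\<^sub>R w)" for t
  have "(H has_real_derivative dir_deriv w (dir_deriv v f) (x + s *\<^sub>R v + t *\<^sub>R w)) (at t)"
    if "0 \<le> t" "t \<le> h" for t
    unfolding H_def using that sub[of s t] s
    by (intro line smooth_on_differentiable[OF smooth_on_dir_deriv[OF sm]]) auto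
  from MVT2[OF h this] obtain t where t: "0 < t" "t < h"
    "H h - H 0 = h * dir_deriv w (dir_deriv v f) (x + s *\<^sub>R v + t *\<^sub>R w)" by auto
  have "H h - H 0 = G' s" by (simp add: H_def G'_def algebra_simps)
  then have "G h - G 0 = h * h * dir_deriv w (dir_deriv v f) (x + s *\<^sub>R v + t *\<^sub>R w)"
    using s t by simp
  moreover have "G h - G 0 = f (x + h *\<^sub>R v + h *\<^sub>R w) - f (x + h *\<^sub>R v) - f (x + h *\<^sub>R w) + f x"
    by (simp add: G_def algebra_simps)
  ultimately show ?thesis using s t by (intro exI[of _ s] exI[of _ t]) auto
qed

text \<open>
  The second difference is symmetric in \<open>v\<close> and \<open>w\<close>. Hence each mixed derivative takes a value that
  the other takes too, at points as close to \<open>x\<close> as desired, and continuity forces them to agree at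
  \<open>x\<close>.
\<close>

lemma dir_deriv_commute_real:
  fixes f :: "'b::real_normed_vector \<Rightarrow> real"
  assumes S: "open S" "x \<in> S" and sm: "smooth_on S f"
  shows "dir_deriv v (dir_deriv w f) x = dir_deriv w (dir_deriv v f) x"
proof (rule ccontr)
  define A where "A = dir_deriv v (dir_deriv w f)"
  define B where "B = dir_deriv w (dir_deriv v f)"
  assume "dir_deriv v (dir_deriv w f) x \<noteq> dir_deriv w (dir_deriv v f) x"
  then have ne: "A x \<noteq> B x" by (simp add: A_def B_def)
  define e where "e = \<bar>A x - B x\<bar> / 2"
  have e: "e > 0" using ne by (simp add: e_def)
  have "isCont A x" "isCont B x"
    using S smooth_on_continuous smooth_on_dir_deriv sm continuous_on_eq_continuous_at
    unfolding A_def B_def by metis+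
  then obtain r1 r2 where r1: "r1 > 0" "\<And>y. dist y x < r1 \<Longrightarrow> dist (A y) (A x) < e"
    and r2: "r2 > 0" "\<And>y. dist y x < r2 \<Longrightarrow> dist (B y) (B x) < e"
    using e unfolding continuous_at_eps_delta by metis
  obtain r3 where r3: "r3 > 0" "ball x r3 \<subseteq> S" using S open_contains_ball by blast
  define r where "r = min r1 (min r2 r3)"
  \<comment> \<open>With this side length both parallelograms stay within distance \<open>r / 2\<close> of \<open>x\<close>.\<close>
  define h where "h = r / (2 * (norm v + norm w + 1))"
  have r: "r > 0" using r1 r2 r3 by (simp add: r_def)
  have pos: "norm v + norm w + 1 > 0" by (smt (verit) norm_ge_zero)
  have h: "h > 0" using r pos by (simp add: h_def)
  have close: "dist (x + s *\<^sub>R v + t *\<^sub>R w) x < r" if "0 \<le> s" "s \<le> h" "0 \<le> t" "t \<le> h" for s t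
  proof -
    have "dist (x + s *\<^sub>R v + t *\<^sub>R w) x = norm (s *\<^sub>R v + t *\<^sub>R w)" by (simp add: dist_norm)
    also have "\<dots> \<le> norm (s *\<^sub>R v) + norm (t *\<^sub>R w)" by (rule norm_triangle_ineq)
    also have "\<dots> = s * norm v + t * norm w" using that by simp
    also have "\<dots> \<le> h * norm v + h * norm w" using that by (intro add_mono mult_right_mono) auto
    also have "\<dots> \<le> h * (norm v + norm w + 1)" using h by (simp add: algebra_simps)
    also have "\<dots> = r / 2" using pos by (simp add: h_def field_simps)
    also have "\<dots> < r" using r by simp
    finally show ?thesis .
  qed
  have inS: "x + s *\<^sub>R v + t *\<^sub>R w \<in> S" if "0 \<le> s" "s \<le> h" "0 \<le> t" "t \<le> h" for s t
    using close[OF that] r3(2) by (auto simp: r_def dist_commute)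
  obtain s t where st: "0 \<le> s" "s \<le> h" "0 \<le> t" "t \<le> h" and
    b: "f (x + h *\<^sub>R v + h *\<^sub>R w) - f (x + h *\<^sub>R v) - f (x + h *\<^sub>R w) + f x = h * h * B (x + s *\<^sub>R v + t *\<^sub>R w)"
    unfolding B_def using real_double_mvt[OF sm h inS] by blast
  have inS': "x + s *\<^sub>R w + t *\<^sub>R v \<in> S" if "0 \<le> s" "s \<le> h" "0 \<le> t" "t \<le> h" for s t
    using inS[OF that(3,4,1,2)] by (simp add: algebra_simps)
  obtain s' t' where st': "0 \<le> s'" "s' \<le> h" "0 \<le> t'" "t' \<le> h" and
    a: "f (x + h *\<^sub>R w + h *\<^sub>R v) - f (x + h *\<^sub>R w) - f (x + h *\<^sub>R v) + f x = h * h * A (x + s' *\<^sub>R w + t' *\<^sub>R v)"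
    unfolding A_def using real_double_mvt[OF sm h inS'] by blast
  have "h * h * A (x + s' *\<^sub>R w + t' *\<^sub>R v) = h * h * B (x + s *\<^sub>R v + t *\<^sub>R w)"
    using a b by (simp add: algebra_simps)
  then have eq: "A (x + t' *\<^sub>R v + s' *\<^sub>R w) = B (x + s *\<^sub>R v + t *\<^sub>R w)"
    using h by (simp add: algebra_simps)
  have "dist (A (x + t' *\<^sub>R v + s' *\<^sub>R w)) (A x) < e"
    using close[OF st'(3,4,1,2)] by (intro r1) (simp add: r_def)
  moreover have "dist (B (x + s *\<^sub>R v + t *\<^sub>R w)) (B x) < e"
    using close[OF st] by (intro r2) (simp add: r_def)
  ultimately show False using eq unfolding e_def dist_real_def by (smt (verit) field_sum_of_halves)
qed

lemma dir_deriv_commute: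
  fixes f :: "'b::real_normed_vector \<Rightarrow> 'c::euclidean_space"
  assumes S: "open S" "x \<in> S" and sm: "smooth_on S f"
  shows "dir_deriv v (dir_deriv w f) x = dir_deriv w (dir_deriv v f) x"
proof (rule euclidean_eqI)
  fix b :: 'c assume "b \<in> Basis"
  have 1: "dir_deriv u (\<lambda>x. f x \<bullet> b) y = dir_deriv u f y \<bullet> b" if "y \<in> S" for u y
    using dir_deriv_linear_apply[OF bounded_linear_inner_left smooth_on_differentiable[OF sm that]] .
  have 2: "dir_deriv u (dir_deriv u' (\<lambda>x. f x \<bullet> b)) x = dir_deriv u (dir_deriv u' f) x \<bullet> b" for u u'
  proof -
    have "dir_deriv u (dir_deriv u' (\<lambda>x. f x \<bullet> b)) x = dir_deriv u (\<lambda>y. dir_deriv u' f y \<bullet> b) x"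
      by (rule dir_deriv_cong_open[OF S 1])
    also have "\<dots> = dir_deriv u (dir_deriv u' f) x \<bullet> b"
      by (rule dir_deriv_linear_apply[OF bounded_linear_inner_left
            smooth_on_differentiable[OF smooth_on_dir_deriv[OF sm] S(2)]])
    finally show ?thesis .
  qed
  have "smooth_on S (\<lambda>x. f x \<bullet> b)"
    using smooth_on_linear_apply[OF S(1) bounded_linear_inner_left sm] .
  from dir_deriv_commute_real[OF S this, of v w]
  show "dir_deriv v (dir_deriv w f) x \<bullet> b = dir_deriv w (dir_deriv v f) x \<bullet> b"
    by (simp add: 2)
qed

section \<open>The Lorentz form and the light cone\<close>

definition lform :: "'a::euclidean_space lorentz \<Rightarrow> 'a lorentz \<Rightarrow> real" where
  "lform v w = fst v * fst w - snd v \<bullet> snd w"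

definition lorentz_linear :: "('a::euclidean_space lorentz \<Rightarrow> 'a lorentz) \<Rightarrow> bool" where
  "lorentz_linear h \<longleftrightarrow> linear h \<and> surj h \<and> (\<forall>v w. lform (h v) (h w) = lform v w)"

text \<open>
  The lift of \<open>E\<close> to the forward light cone that meets the ray of \<open>(1, stereo_inv x)\<close>. It is scaled to
  be polynomial in \<open>x\<close>; in this scaling distances in \<open>E\<close> become scalar products.
\<close>

definition lightcone :: "'a::euclidean_space \<Rightarrow> 'a lorentz" where
  "lightcone x = (1 + (norm x)\<^sup>2, (2 *\<^sub>R x, 1 - (norm x)\<^sup>2))"

definition lightcone_deriv :: "'a::euclidean_space \<Rightarrow> 'a \<Rightarrow> 'a lorentz" where
  "lightcone_deriv v x = (2 * (x \<bullet> v), (2 *\<^sub>R v, - 2 * (x \<bullet> v)))"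

text \<open>
  The null direction over the pole that represents the point at infinity. It also is half of every
  second derivative of \<open>lightcone\<close> in a unit direction, and completes \<open>lightcone x\<close> and its partial
  derivatives to a basis.
\<close>

definition infinity_ray :: "'a::euclidean_space lorentz" where
  "infinity_ray = (1, (0, -1))"

text \<open>
  The contraction of \<open>B\<close> with the inverse of the Lorentz metric; \<open>lform A A\<close> is \<open>1\<close> for the time axis
  and \<open>-1\<close> for all other axes.
\<close>

definition wave_trace :: "('a::euclidean_space lorentz \<Rightarrow> 'a lorentz \<Rightarrow> complex) \<Rightarrow> complex" where
  "wave_trace B = (\<Sum>A\<in>Basis. lform A A *\<^sub>R B A A)"

lemma bounded_bilinear_lform: "bounded_bilinear lform"
proof -
  have "bilinear (lform :: 'a lorentz \<Rightarrow> 'a lorentz \<Rightarrow> real)"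
    unfolding bilinear_def lform_def
    by (auto intro!: linearI simp: algebra_simps inner_add_left inner_add_right)
  then show ?thesis by (simp add: bilinear_conv_bounded_bilinear)
qed

lemmas lform_simps = bounded_bilinear.add_left[OF bounded_bilinear_lform]
  bounded_bilinear.add_right[OF bounded_bilinear_lform]
  bounded_bilinear.scaleR_left[OF bounded_bilinear_lform]
  bounded_bilinear.scaleR_right[OF bounded_bilinear_lform]
  bounded_bilinear.diff_left[OF bounded_bilinear_lform]
  bounded_bilinear.diff_right[OF bounded_bilinear_lform]

lemma lform_commute: "lform v w = lform w v"
  by (simp add: lform_def inner_commute)

lemma lorentz_form_eq_lform: "lorentz_form v = lform v v"
  unfolding lorentz_form_def lform_def power2_norm_eq_inner by (simp add: power2_eq_square)

lemma lorentz_linearD: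
  assumes "lorentz_linear h"
  shows "linear h" "surj h" "lform (h v) (h w) = lform v w"
  using assms unfolding lorentz_linear_def by blast+

lemma lform_lightcone: "lform (lightcone y) (lightcone z) = 2 * (norm (y - z))\<^sup>2"
  unfolding lform_def lightcone_def power2_norm_eq_inner
  by (simp add: algebra_simps inner_commute)

lemma lform_lightcone_deriv: "lform (lightcone_deriv v y) (lightcone z) = 4 * ((y - z) \<bullet> v)"
  unfolding lform_def lightcone_def lightcone_deriv_def power2_norm_eq_inner
  by (simp add: algebra_simps inner_commute)

lemma lform_lightcone_deriv2: "lform (lightcone_deriv v y) (lightcone_deriv w z) = - 4 * (v \<bullet> w)"
  unfolding lform_def lightcone_deriv_def
  by (simp add: algebra_simps inner_commute)

lemma lform_infinity_ray [simp]:
  "lform infinity_ray (lightcone z) = 2" "lform infinity_ray (lightcone_deriv v z) = 0"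
  "lform infinity_ray infinity_ray = 0"
  by (simp_all add: lform_def lightcone_def lightcone_deriv_def infinity_ray_def)

lemma has_derivative_lightcone: "(lightcone has_derivative (\<lambda>v. lightcone_deriv v x)) (at x)"
  unfolding lightcone_def lightcone_deriv_def power2_norm_eq_inner
  by (auto intro!: derivative_eq_intros simp: inner_commute)

lemma has_derivative_lightcone_deriv:
  "(lightcone_deriv v has_derivative (\<lambda>w. (2 * (v \<bullet> w)) *\<^sub>R infinity_ray)) (at x)"
  unfolding lightcone_deriv_def infinity_ray_def
  by (auto intro!: derivative_eq_intros simp: inner_commute)

lemma dir_deriv_lightcone: "dir_deriv v lightcone = lightcone_deriv v"
  by (rule ext) (rule dir_derivI[OF has_derivative_lightcone])

lemma smooth_lightcone: "smooth_on S lightcone"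
proof -
  have 2: "C_on n UNIV (lightcone_deriv v)" for v :: 'a and n
    by (rule C_on_SucD[OF C_on_SucI[OF open_UNIV has_derivative_lightcone_deriv C_on_const]])
  have 3: "C_on n UNIV (lightcone :: 'a \<Rightarrow> _)" for n
    by (rule C_on_SucD[OF C_on_SucI[OF open_UNIV has_derivative_lightcone 2]])
  show ?thesis unfolding smooth_on_def by (intro allI C_on_subset[OF 3] subset_UNIV)
qed

lemma lorentz_Basis:
  "(Basis :: 'a::euclidean_space lorentz set) =
     insert (1, 0) ((\<lambda>b. (0, (b, 0))) ` Basis \<union> {(0, (0, 1))})"
  by (auto simp: Basis_prod_def image_iff)

lemma wave_trace_expand:
  "wave_trace B = B (1, 0) (1, 0) - (\<Sum>b\<in>Basis. B (0, (b, 0)) (0, (b, 0))) - B (0, (0, 1)) (0, (0, 1))"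
proof -
  have "wave_trace B = (\<Sum>A\<in>insert (1, 0) ((\<lambda>b. (0, (b, 0))) ` Basis \<union> {(0, (0, 1))}). lform A A *\<^sub>R B A A)"
    by (simp add: wave_trace_def lorentz_Basis)
  also have "\<dots> = B (1, 0) (1, 0) + ((\<Sum>A\<in>(\<lambda>b. (0, (b, 0))) ` Basis. lform A A *\<^sub>R B A A) - B (0, (0, 1)) (0, (0, 1)))"
  proof -
    have "finite ((\<lambda>b::'a. (0::real, (b, 0::real))) ` Basis)" by simp
    moreover have "(0, (0, 1)) \<notin> (\<lambda>b::'a. (0::real, (b, 0::real))) ` Basis" by auto
    moreover have "(1, 0) \<notin> (\<lambda>b::'a. (0::real, (b, 0::real))) ` Basis \<union> {(0, (0, 1))}" by auto
    moreover have "lform (1, 0) (1, 0 :: 'a \<times> real) = 1" "lform (0, (0, 1)) (0, (0::'a, 1)) = -1"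
      by (simp_all add: lform_def)
    ultimately show ?thesis by simp
  qed
  also have "(\<Sum>A\<in>(\<lambda>b::'a. (0::real, (b, 0::real))) ` Basis. lform A A *\<^sub>R B A A)
      = (\<Sum>b\<in>Basis. - B (0, (b, 0)) (0, (b, 0)))"
    by (subst sum.reindex) (auto simp: inj_on_def lform_def)
  finally show ?thesis by (simp add: sum_negf)
qed

lemma lform_Basis:
  assumes "A \<in> Basis"
  shows "lform v A = lform A A * (v \<bullet> A)" "lform A A * lform A A = 1"
  using assms by (auto simp: lorentz_Basis lform_def inner_Pair inner_prod_def)

lemma lform_nondegenerate:
  assumes "\<And>u. lform v u = lform w u" shows "v = w"
proof (rule euclidean_eqI)
  fix A :: "'a lorentz" assume A: "A \<in> Basis"
  show "v \<bullet> A = w \<bullet> A"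
    using assms[of A] lform_Basis[OF A] by (metis mult_cancel_left mult_zero_left zero_neq_one)
qed

text \<open>
  Completeness of the standard basis with respect to the Lorentz form.
\<close>

lemma sum_lform_Basis: "(\<Sum>A\<in>Basis. lform A A * (lform A v * lform A w)) = lform v w"
proof -
  have "lform v w = (\<Sum>A\<in>Basis. (v \<bullet> A) * lform A w)"
  proof -
    have "lform v w = lform (\<Sum>A\<in>Basis. (v \<bullet> A) *\<^sub>R A) w"
      by (simp add: euclidean_representation)
    also have "\<dots> = (\<Sum>A\<in>Basis. (v \<bullet> A) * lform A w)"
      by (simp only: bounded_bilinear.sum_left[OF bounded_bilinear_lform] lform_simps) simp
    finally show ?thesis .
  qed
  also have "\<dots> = (\<Sum>A\<in>Basis. lform A A * (lform A v * lform A w))"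
  proof (rule sum.cong[OF refl])
    fix A :: "'a lorentz" assume A: "A \<in> Basis"
    have "lform A A * (lform A v * lform A w) = (lform A A * lform A A) * (v \<bullet> A) * lform A w"
      using lform_Basis(1)[OF A, of v] lform_commute[of A v] by (simp add: mult_ac)
    then show "(v \<bullet> A) * lform A w = lform A A * (lform A v * lform A w)"
      using lform_Basis(2)[OF A] by (simp only: mult_1)
  qed
  finally show ?thesis by simp
qed

lemma bilinear_frame_expansion:
  assumes "bilinear B"
  shows "B v w = (\<Sum>C\<in>Basis. \<Sum>D\<in>Basis. ((v \<bullet> C) * (w \<bullet> D)) *\<^sub>R B C D)"
proof -
  have "B v w = B (\<Sum>C\<in>Basis. (v \<bullet> C) *\<^sub>R C) (\<Sum>D\<in>Basis. (w \<bullet> D) *\<^sub>R D)"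
    by (simp add: euclidean_representation)
  also have "\<dots> = (\<Sum>C\<in>Basis. \<Sum>D\<in>Basis. ((v \<bullet> C) * (w \<bullet> D)) *\<^sub>R B C D)"
    by (simp add: bilinear_sum[OF assms] sum.cartesian_product bilinear_lmul[OF assms]
        bilinear_rmul[OF assms] mult.commute)
  finally show ?thesis .
qed

text \<open>
  The coefficient of \<open>B C D\<close> on the left is, up to the signs of \<open>C\<close> and \<open>D\<close>, the sum over the basis of
  \<open>\<langle>A, h\<^sup>-\<^sup>1C\<rangle>\<langle>A, h\<^sup>-\<^sup>1D\<rangle>\<close>, which equals \<open>\<langle>h\<^sup>-\<^sup>1C, h\<^sup>-\<^sup>1D\<rangle> = \<langle>C, D\<rangle>\<close>.
\<close>

lemma wave_trace_invariant:
  assumes B: "bilinear B" and h: "lorentz_linear h"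
  shows "wave_trace (\<lambda>v w. B (h v) (h w)) = wave_trace B"
proof -
  have coeff: "(\<Sum>A\<in>Basis. lform A A * ((h A \<bullet> C) * (h A \<bullet> D))) = (if C = D then lform C C else 0)"
    if C: "C \<in> Basis" and D: "D \<in> Basis" for C D
  proof -
    obtain C' D' where C': "h C' = C" and D': "h D' = D"
      using h unfolding lorentz_linear_def surj_def by metis
    have "lform A C' = lform C C * (h A \<bullet> C)" for A
      using h lform_Basis(1)[OF C, of "h A"] C' unfolding lorentz_linear_def by metis
    then have hC: "h A \<bullet> C = lform C C * lform A C'" for A
      using lform_Basis(2)[OF C] by (metis mult.assoc mult_1)
    have "lform A D' = lform D D * (h A \<bullet> D)" for A
      using h lform_Basis(1)[OF D, of "h A"] D' unfolding lorentz_linear_def by metis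
    then have hD: "h A \<bullet> D = lform D D * lform A D'" for A
      using lform_Basis(2)[OF D] by (metis mult.assoc mult_1)
    have "(\<Sum>A\<in>Basis. lform A A * ((h A \<bullet> C) * (h A \<bullet> D)))
        = lform C C * lform D D * (\<Sum>A\<in>Basis. lform A A * (lform A C' * lform A D'))"
      by (simp add: hC hD sum_distrib_left mult_ac)
    also have "\<dots> = lform C C * lform D D * lform C D"
      using h C' D' unfolding sum_lform_Basis lorentz_linear_def by metis
    also have "lform C D = lform D D * (C \<bullet> D)" by (rule lform_Basis(1)[OF D])
    finally show ?thesis
      using lform_Basis(2)[OF D] by (auto simp: inner_Basis[OF C D] mult.assoc)
  qed
  have "wave_trace (\<lambda>v w. B (h v) (h w))
     = (\<Sum>A\<in>Basis. \<Sum>C\<in>Basis. \<Sum>D\<in>Basis. (lform A A * ((h A \<bullet> C) * (h A \<bullet> D))) *\<^sub>R B C D)"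
    unfolding wave_trace_def
    by (subst bilinear_frame_expansion[OF B]) (simp add: scaleR_sum_right)
  also have "\<dots> = (\<Sum>C\<in>Basis. \<Sum>D\<in>Basis. \<Sum>A\<in>Basis. (lform A A * ((h A \<bullet> C) * (h A \<bullet> D))) *\<^sub>R B C D)"
  proof -
    have "(\<Sum>A\<in>Basis. \<Sum>C\<in>Basis. \<Sum>D\<in>Basis. F A C D) = (\<Sum>C\<in>Basis. \<Sum>D\<in>Basis. \<Sum>A\<in>Basis. F A C D)"
      for F :: "'a lorentz \<Rightarrow> 'a lorentz \<Rightarrow> 'a lorentz \<Rightarrow> complex"
      by (subst sum.swap) (intro sum.cong refl sum.swap)
    then show ?thesis .
  qed
  also have "\<dots> = (\<Sum>C\<in>Basis. \<Sum>D\<in>Basis. (if C = D then lform C C else 0) *\<^sub>R B C D)"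
    by (intro sum.cong refl) (simp only: scaleR_sum_left[symmetric] coeff)
  also have "\<dots> = (\<Sum>C\<in>Basis. \<Sum>D\<in>Basis. (if C = D then lform C C *\<^sub>R B C C else 0))"
    by (intro sum.cong refl) auto
  also have "\<dots> = wave_trace B"
    by (simp add: wave_trace_def)
  finally show ?thesis .
qed

text \<open>
  In the frame of \<open>\<xi>\<close>, \<open>\<eta>\<close> and the \<open>\<partial>\<^sub>b\<xi>\<close> the only scalar products that do not vanish are \<open>\<langle>\<xi>,\<eta>\<rangle> = 2\<close> and
  \<open>\<langle>\<partial>\<^sub>b\<xi>,\<partial>\<^sub>b\<xi>\<rangle> = -4\<close>; the dual frame gives the coefficients. This is verified by expanding
  \<open>\<xi> = e\<^sub>0 + e\<^sub>l + |x|\<^sup>2\<eta> + 2x\<close>, with \<open>e\<^sub>0\<close> and \<open>e\<^sub>l\<close> the first and last axis, and \<open>\<partial>\<^sub>b\<xi> = 2(x\<^sub>b\<eta> + b)\<close>.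
\<close>

lemma wave_trace_lightcone_frame:
  assumes B: "bilinear B"
  shows "wave_trace B = (B (lightcone x) infinity_ray + B infinity_ray (lightcone x)) / 2
      - (\<Sum>b\<in>Basis. B (lightcone_deriv b x) (lightcone_deriv b x)) / 4"
proof -
  define e0 :: "'a lorentz" where "e0 = (1, 0)"
  define el :: "'a lorentz" where "el = (0, (0, 1))"
  define emb :: "'a \<Rightarrow> 'a lorentz" where "emb v = (0, (v, 0))" for v
  note bil = bilinear_ladd[OF B] bilinear_radd[OF B] bilinear_lmul[OF B] bilinear_rmul[OF B]
    bilinear_lsub[OF B] bilinear_rsub[OF B]
  have eta: "infinity_ray = e0 - el" by (simp add: infinity_ray_def e0_def el_def)
  have xi: "lightcone x = e0 + el + (norm x)\<^sup>2 *\<^sub>R infinity_ray + 2 *\<^sub>R emb x"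
    by (simp add: lightcone_def infinity_ray_def e0_def el_def emb_def)
  have fr: "lightcone_deriv b x = 2 *\<^sub>R ((x \<bullet> b) *\<^sub>R infinity_ray + emb b)" for b
    by (simp add: lightcone_deriv_def infinity_ray_def emb_def)
  have emb: "emb x = (\<Sum>b\<in>Basis. (x \<bullet> b) *\<^sub>R emb b)"
  proof -
    have "linear (emb :: 'a \<Rightarrow> _)" unfolding emb_def by (rule linearI) auto
    then have "emb (\<Sum>b\<in>Basis. (x \<bullet> b) *\<^sub>R b) = (\<Sum>b\<in>Basis. (x \<bullet> b) *\<^sub>R emb b)"
      using linear_sum[of emb "\<lambda>b. (x \<bullet> b) *\<^sub>R b" Basis] linear_scale[of emb] by simp
    then show ?thesis by (simp add: euclidean_representation)
  qed
  have n: "(norm x)\<^sup>2 = (\<Sum>b\<in>Basis. (x \<bullet> b) * (x \<bullet> b))"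
    by (simp add: power2_norm_eq_inner euclidean_inner[of x x])
  have lin: "linear (B infinity_ray)" "linear (\<lambda>v. B v infinity_ray)"
    using B unfolding bilinear_def by blast+
  have l: "B infinity_ray (emb x) = (\<Sum>b\<in>Basis. (x \<bullet> b) *\<^sub>R B infinity_ray (emb b))"
    unfolding emb by (simp add: linear_sum[OF lin(1)] linear_scale[OF lin(1)])
  have r: "B (emb x) infinity_ray = (\<Sum>b\<in>Basis. (x \<bullet> b) *\<^sub>R B (emb b) infinity_ray)"
    unfolding emb by (simp add: linear_sum[OF lin(2)] linear_scale[OF lin(2)])
  have q: "(norm x)\<^sup>2 *\<^sub>R B infinity_ray infinity_ray
      = (\<Sum>b\<in>Basis. ((x \<bullet> b) * (x \<bullet> b)) *\<^sub>R B infinity_ray infinity_ray)"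
    unfolding n by (simp add: scaleR_sum_left)
  have "(\<Sum>b\<in>Basis. B (lightcone_deriv b x) (lightcone_deriv b x))
     = (\<Sum>b\<in>Basis. 4 *\<^sub>R (((x \<bullet> b) * (x \<bullet> b)) *\<^sub>R B infinity_ray infinity_ray
        + (x \<bullet> b) *\<^sub>R B infinity_ray (emb b) + (x \<bullet> b) *\<^sub>R B (emb b) infinity_ray + B (emb b) (emb b)))"
    unfolding fr by (intro sum.cong refl) (simp only: bil, simp add: scaleR_conv_of_real algebra_simps)
  also have "\<dots> = 4 *\<^sub>R ((norm x)\<^sup>2 *\<^sub>R B infinity_ray infinity_ray + B infinity_ray (emb x)
       + B (emb x) infinity_ray + (\<Sum>b\<in>Basis. B (emb b) (emb b)))"
    unfolding q l r by (simp only: scaleR_sum_right[symmetric] sum.distrib)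
  finally have fsum: "(\<Sum>b\<in>Basis. B (lightcone_deriv b x) (lightcone_deriv b x))
     = 4 * ((norm x)\<^sup>2 *\<^sub>R B infinity_ray infinity_ray + B infinity_ray (emb x)
       + B (emb x) infinity_ray + (\<Sum>b\<in>Basis. B (emb b) (emb b)))"
    by (simp add: scaleR_conv_of_real)
  have "B (lightcone x) infinity_ray + B infinity_ray (lightcone x)
      = B (e0 + el) infinity_ray + B infinity_ray (e0 + el) + 2 * (norm x)\<^sup>2 *\<^sub>R B infinity_ray infinity_ray
        + 2 * B infinity_ray (emb x) + 2 * B (emb x) infinity_ray"
    unfolding xi bil by (simp add: scaleR_conv_of_real algebra_simps)
  moreover have "B (e0 + el) infinity_ray + B infinity_ray (e0 + el) = 2 * (B e0 e0 - B el el)"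
    unfolding eta bil by (simp add: algebra_simps)
  moreover have "wave_trace B = B e0 e0 - (\<Sum>b\<in>Basis. B (emb b) (emb b)) - B el el"
    unfolding wave_trace_expand e0_def el_def emb_def ..
  ultimately show ?thesis
    unfolding fsum by (simp only:) (simp add: scaleR_conv_of_real algebra_simps add_divide_distrib diff_divide_distrib)
qed

text \<open>
  The same frame formula, applied to the bilinear form \<open>\<langle>v,N\<rangle>\<langle>w,u\<rangle>\<close>, expands \<open>N\<close>.
\<close>

lemma lightcone_expansion:
  "N = (lform N infinity_ray / 2) *\<^sub>R lightcone x + (lform N (lightcone x) / 2) *\<^sub>R infinity_ray
     - (1/4) *\<^sub>R (\<Sum>b\<in>Basis. lform N (lightcone_deriv b x) *\<^sub>R lightcone_deriv b x)"
proof -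
  have tr: "complex_of_real (lform N u) = wave_trace (\<lambda>v w. of_real (lform v N * lform w u))" for u
    unfolding wave_trace_def sum_lform_Basis[symmetric, of N u] by (simp add: scaleR_conv_of_real)
  have bl: "bilinear (\<lambda>v w. complex_of_real (lform v N * lform w u))" for u
    unfolding bilinear_def
    by (intro conjI allI linearI; simp only: lform_simps; simp add: algebra_simps scaleR_conv_of_real)
  show ?thesis
  proof (rule lform_nondegenerate)
    fix u
    have "complex_of_real (lform N u) = of_real ((lform (lightcone x) N * lform infinity_ray u
        + lform infinity_ray N * lform (lightcone x) u) / 2
        - (\<Sum>b\<in>Basis. lform (lightcone_deriv b x) N * lform (lightcone_deriv b x) u) / 4)"
      unfolding tr wave_trace_lightcone_frame[OF bl, of u x] by simp
    then have "lform N u = (lform (lightcone x) N * lform infinity_ray u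
        + lform infinity_ray N * lform (lightcone x) u) / 2
        - (\<Sum>b\<in>Basis. lform (lightcone_deriv b x) N * lform (lightcone_deriv b x) u) / 4"
      by (simp only: of_real_eq_iff)
    then show "lform N u = lform ((lform N infinity_ray / 2) *\<^sub>R lightcone x
       + (lform N (lightcone x) / 2) *\<^sub>R infinity_ray
     - (1/4) *\<^sub>R (\<Sum>b\<in>Basis. lform N (lightcone_deriv b x) *\<^sub>R lightcone_deriv b x)) u"
      by (simp add: lform_simps bounded_bilinear.sum_left[OF bounded_bilinear_lform] lform_commute[of _ N]
          field_simps)
  qed
qed

subsection \<open>The action on null vectors and on the flat chart\<close>

text \<open>
  Homogeneous coordinates on the cone, normalised by \<open>cone_height (lightcone x) = 1\<close> and
  \<open>cone_point (lightcone x) = x\<close>.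
\<close>

definition cone_height :: "'a::euclidean_space lorentz \<Rightarrow> real" where
  "cone_height X = (fst X + snd (snd X)) / 2"

definition cone_point :: "'a::euclidean_space lorentz \<Rightarrow> 'a" where
  "cone_point X = inverse (2 * cone_height X) *\<^sub>R fst (snd X)"

lemma cone_lightcone [simp]: "cone_height (lightcone x) = 1" "cone_point (lightcone x) = x"
  by (simp_all add: cone_height_def cone_point_def lightcone_def)

lemma cone_scaleR: "cone_height (r *\<^sub>R X) = r * cone_height X"
  "r \<noteq> 0 \<Longrightarrow> cone_point (r *\<^sub>R X) = cone_point X"
proof -
  show h: "cone_height (r *\<^sub>R X) = r * cone_height X"
    by (simp add: cone_height_def field_simps)
  show "cone_point (r *\<^sub>R X) = cone_point X" if "r \<noteq> 0"
    using that unfolding cone_point_def h by simp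
qed

lemma null_vector_decomposition:
  assumes "lform X X = 0" "cone_height X \<noteq> 0"
  shows "X = cone_height X *\<^sub>R lightcone (cone_point X)"
proof -
  obtain t e l where X: "X = (t, (e, l))" by (metis prod.collapse)
  have n: "t * t = e \<bullet> e + l * l" using assms(1) by (simp add: X lform_def)
  define c where "c = (t + l) / 2"
  have c: "c \<noteq> 0" "cone_height X = c" using assms(2) by (auto simp: X cone_height_def c_def)
  have p: "cone_point X = (1 / (2 * c)) *\<^sub>R e" unfolding cone_point_def c(2) by (simp add: X inverse_eq_divide)
  have "e \<bullet> e = 2 * c * (t - l)" using n by (simp add: c_def algebra_simps)
  then have N: "c * (norm (cone_point X))\<^sup>2 = (t - l) / 2"
    unfolding p power2_norm_eq_inner using c(1) by simp
  have tl: "c + (t - l) / 2 = t" "c - (t - l) / 2 = l" by (simp_all add: c_def field_simps)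
  have p2: "(2 * c) *\<^sub>R cone_point X = e" unfolding p using c(1) by simp
  have "c *\<^sub>R lightcone (cone_point X) = (c + c * (norm (cone_point X))\<^sup>2, ((2 * c) *\<^sub>R cone_point X, c - c * (norm (cone_point X))\<^sup>2))"
    by (simp add: lightcone_def algebra_simps)
  also have "\<dots> = X" unfolding N tl p2 by (simp add: X)
  finally show ?thesis using c by simp
qed

lemma null_vector_time_zero:
  assumes "lform X X = 0" "fst X = 0" shows "X = 0"
proof -
  have "snd X \<bullet> snd X = 0" using assms unfolding lform_def by simp
  then show ?thesis using assms(2) by (simp add: prod_eq_iff)
qed

text \<open>
  The reciprocal of the conformal factor; it is a quadratic polynomial in \<open>x\<close> whose zero, if there
  is one, is the point sent to infinity.
\<close>

definition conf_den :: "('a::euclidean_space lorentz \<Rightarrow> 'a lorentz) \<Rightarrow> 'a \<Rightarrow> real" where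
  "conf_den h x = cone_height (h (lightcone x))"

lemma lorentz_linear_null:
  "lorentz_linear h \<Longrightarrow> lform (h (lightcone x)) (h (lightcone x)) = 0"
  by (simp add: lorentz_linearD(3) lform_lightcone)

lemma lorentz_linear_time_nonzero:
  assumes h: "lorentz_linear h" shows "fst (h (lightcone x)) \<noteq> 0"
proof
  assume "fst (h (lightcone x)) = 0"
  then have 0: "h (lightcone x) = 0"
    using null_vector_time_zero lorentz_linear_null[OF h] by blast
  have "lform (h (lightcone x)) (h infinity_ray) = 2"
    by (simp add: lorentz_linearD(3)[OF h] lform_commute[of "lightcone x" infinity_ray])
  then show False by (simp add: 0 lform_def)
qed

lemma sphere_act_lightcone:
  assumes h: "lorentz_linear h"
  shows "sphere_act h (stereo_inv x) = snd (h (lightcone x)) /\<^sub>R fst (h (lightcone x))"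
proof -
  define r where "r = 1 + (norm x)\<^sup>2"
  have r: "r \<noteq> 0" unfolding r_def by (smt (verit) zero_le_power2)
  have "(1, stereo_inv x) = inverse r *\<^sub>R lightcone x"
    using r by (simp add: stereo_inv_def lightcone_def r_def[symmetric] divide_inverse mult_ac)
  then have "h (1, stereo_inv x) = inverse r *\<^sub>R h (lightcone x)"
    by (simp add: linear_scale[OF lorentz_linearD(1)[OF h]])
  then show ?thesis using r by (simp add: sphere_act_def)
qed

lemma act_eq_cone_point:
  assumes h: "lorentz_linear h"
  shows "act h x = cone_point (h (lightcone x))"
proof -
  obtain t e l where X: "h (lightcone x) = (t, (e, l))" by (metis prod.collapse)
  have t: "t \<noteq> 0" using lorentz_linear_time_nonzero[OF h, of x] by (simp add: X)
  have "1 + inverse t * l = inverse t * (t + l)" using t by (simp add: distrib_left)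
  then have "inverse (1 + inverse t * l) * inverse t = inverse (t + l)"
    using t by simp
  then have "inverse (1 + inverse t * l) *\<^sub>R (inverse t *\<^sub>R e) = inverse (t + l) *\<^sub>R e"
    by simp
  moreover have "2 * ((t + l) / 2) = t + l" by simp
  ultimately show ?thesis
    unfolding act_def sphere_act_lightcone[OF h] X stereo_def cone_point_def cone_height_def
      scaleR_prod_def fst_conv snd_conv by (simp only: real_scaleR_def)
qed

lemma act_defined_iff:
  assumes h: "lorentz_linear h"
  shows "act_defined h x \<longleftrightarrow> conf_den h x \<noteq> 0"
proof -
  obtain t e l where X: "h (lightcone x) = (t, (e, l))" by (metis prod.collapse)
  have t: "t \<noteq> 0" using lorentz_linear_time_nonzero[OF h, of x] by (simp add: X)
  have n: "t * t = e \<bullet> e + l * l" using lorentz_linear_null[OF h, of x] by (simp add: X lform_def)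
  have "(e, l) /\<^sub>R t = (0, -1) \<longleftrightarrow> e = 0 \<and> l = - t"
    using t by (simp add: inverse_eq_divide nonzero_divide_eq_eq)
  also have "\<dots> \<longleftrightarrow> t + l = 0"
  proof
    assume "t + l = 0"
    then have l: "l = - t" by linarith
    then have "e \<bullet> e = 0" using n by simp
    with l show "e = 0 \<and> l = - t" by simp
  qed simp
  finally show ?thesis
    unfolding act_defined_def sphere_act_lightcone[OF h] conf_den_def cone_height_def X by simp
qed

text \<open>
  A null vector is determined by its height and its affine point, and both are read off from the
  definition of the action.
\<close>

lemma lorentz_lightcone_act:
  assumes "lorentz_linear h" "conf_den h x \<noteq> 0"
  shows "h (lightcone x) = conf_den h x *\<^sub>R lightcone (act h x)"
  unfolding act_eq_cone_point[OF assms(1)] conf_den_def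
  by (rule null_vector_decomposition[OF lorentz_linear_null[OF assms(1)] assms(2)[unfolded conf_den_def]])

section \<open>The tractor D operator on densities\<close>

text \<open>
  The component along \<open>N\<close> of the tractor D operator of conformal geometry (Thomas operator) on
  densities of weight \<open>-s\<close>, written in the flat chart. With \<open>s = \<rho> + \<lambda>\<close> the factor
  \<open>s - \<rho> + 1\<close> is \<open>\<lambda> + 1\<close>.
\<close>

definition tractor_D :: "complex \<Rightarrow> 'a::euclidean_space lorentz \<Rightarrow> ('a \<Rightarrow> complex) \<Rightarrow> 'a \<Rightarrow> complex" where
  "tractor_D s N u x =
     of_real (lform N (lightcone x)) * (\<Sum>b\<in>Basis. dir_deriv b (dir_deriv b u) x)
   + 2 * (s - rho TYPE('a) + 1) * (\<Sum>b\<in>Basis. of_real (lform N (lightcone_deriv b x)) * dir_deriv b u x)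
   + 4 * (s - rho TYPE('a) + 1) * s * of_real (lform N infinity_ray) * u x"

definition wave_op :: "('a::euclidean_space lorentz \<Rightarrow> complex) \<Rightarrow> 'a lorentz \<Rightarrow> complex" where
  "wave_op U X = wave_trace (\<lambda>v w. dir_deriv v (dir_deriv w U) X)"

definition homogeneous_on :: "'b::real_vector set \<Rightarrow> complex \<Rightarrow> ('b \<Rightarrow> complex) \<Rightarrow> bool" where
  "homogeneous_on S s U \<longleftrightarrow>
     (\<forall>X\<in>S. \<forall>r>0. r *\<^sub>R X \<in> S \<and> U (r *\<^sub>R X) = of_real r powr (- s) * U X)"

lemma dir_deriv_cmult:
  fixes f :: "'b::real_normed_vector \<Rightarrow> complex"
  assumes "f differentiable (at x)"
  shows "dir_deriv v (\<lambda>x. c * f x) x = c * dir_deriv v f x"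
  by (rule dir_deriv_linear_apply[OF bounded_linear_mult_right assms])

lemma homogeneous_on_dir_deriv:
  assumes S: "open S" and sm: "smooth_on S U" and hom: "homogeneous_on S s U"
  shows "homogeneous_on S (s + 1) (dir_deriv v U)"
  unfolding homogeneous_on_def
proof (intro ballI allI impI conjI)
  fix X and r :: real assume X: "X \<in> S" and r: "r > 0"
  show rX: "r *\<^sub>R X \<in> S" using hom X r by (simp add: homogeneous_on_def)
  have d: "((*\<^sub>R) r has_derivative (*\<^sub>R) r) (at X)"
    by (rule bounded_linear_imp_has_derivative[OF bounded_linear_scaleR_right])
  have "dir_deriv v (\<lambda>X. U (r *\<^sub>R X)) X = dir_deriv (r *\<^sub>R v) U (r *\<^sub>R X)"
    using dir_deriv_compose(1)[of "(*\<^sub>R) r" X U v] d smooth_on_differentiable[OF sm rX]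
    by (auto simp: dir_derivI[OF d] differentiable_def)
  also have "\<dots> = of_real r * dir_deriv v U (r *\<^sub>R X)"
    using linear_scale[OF linear_dir_deriv[OF smooth_on_differentiable[OF sm rX]]]
    by (simp add: scaleR_conv_of_real)
  finally have 1: "dir_deriv v (\<lambda>X. U (r *\<^sub>R X)) X = of_real r * dir_deriv v U (r *\<^sub>R X)" .
  have "dir_deriv v (\<lambda>X. U (r *\<^sub>R X)) X = dir_deriv v (\<lambda>X. of_real r powr (- s) * U X) X"
    using hom r by (intro dir_deriv_cong_open[OF S X]) (simp add: homogeneous_on_def)
  also have "\<dots> = of_real r powr (- s) * dir_deriv v U X"
    by (rule dir_deriv_cmult[OF smooth_on_differentiable[OF sm X]])
  finally have "dir_deriv v U (r *\<^sub>R X) = of_real r powr (- s) / of_real r * dir_deriv v U X"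
    using 1 r by (simp add: nonzero_eq_divide_eq mult.commute)
  moreover have "of_real r powr (- s) / of_real r = complex_of_real r powr (- (s + 1))"
    using r powr_diff[of "complex_of_real r" "- s" 1] by simp
  ultimately show "dir_deriv v U (r *\<^sub>R X) = of_real r powr (- (s + 1)) * dir_deriv v U X" by simp
qed

lemma euler_homogeneous:
  assumes S: "open S" and sm: "smooth_on S U" and hom: "homogeneous_on S s U" and X: "X \<in> S"
  shows "dir_deriv X U X = - s * U X"
proof -
  have d: "((\<lambda>t::real. t *\<^sub>R X) has_derivative (\<lambda>t. t *\<^sub>R X)) (at 1)"
    by (rule bounded_linear_imp_has_derivative[OF bounded_linear_scaleR_left])
  have "dir_deriv 1 (\<lambda>t::real. U (t *\<^sub>R X)) 1 = dir_deriv X U X"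
    using dir_deriv_compose(1)[of "\<lambda>t::real. t *\<^sub>R X" 1 U 1] d smooth_on_differentiable[OF sm X]
    by (auto simp: dir_derivI[OF d] differentiable_def)
  moreover have "dir_deriv 1 (\<lambda>t::real. U (t *\<^sub>R X)) 1 = dir_deriv 1 (\<lambda>t. of_real t powr (- s) * U X) 1"
    using hom X by (intro dir_deriv_cong_open[of "{0<..}"]) (auto simp: homogeneous_on_def)
  moreover have "dir_deriv 1 (\<lambda>t. complex_of_real t powr (- s) * U X) 1 = - s * U X"
    using dir_derivI[OF has_derivative_mult_left[OF has_derivative_powr_pos[of 1 "- s"]], of 1 "U X"]
    by simp
  ultimately show ?thesis by simp
qed

lemma bilinear_second_dir_deriv:
  assumes S: "open S" "X \<in> S" and sm: "smooth_on S U"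
  shows "bilinear (\<lambda>v w. dir_deriv v (dir_deriv w U) X)"
  unfolding bilinear_def
proof (intro conjI allI)
  show "linear (\<lambda>v. dir_deriv v (dir_deriv w U) X)" for w
    by (rule linear_dir_deriv[OF smooth_on_differentiable[OF smooth_on_dir_deriv[OF sm] S(2)]])
  note diff = smooth_on_differentiable[OF smooth_on_dir_deriv[OF sm] S(2)]
  show "linear (\<lambda>w. dir_deriv v (dir_deriv w U) X)" for v
  proof (rule linearI)
    fix a b
    have "dir_deriv v (dir_deriv (a + b) U) X = dir_deriv v (\<lambda>Y. dir_deriv a U Y + dir_deriv b U Y) X"
      by (rule dir_deriv_cong_open[OF S linear_add[OF linear_dir_deriv[OF smooth_on_differentiable[OF sm]]]])
    then show "dir_deriv v (dir_deriv (a + b) U) X = dir_deriv v (dir_deriv a U) X + dir_deriv v (dir_deriv b U) X"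
      by (simp add: dir_deriv_add[OF diff diff])
  next
    fix r :: real and a
    have "dir_deriv v (dir_deriv (r *\<^sub>R a) U) X = dir_deriv v (\<lambda>Y. r *\<^sub>R dir_deriv a U Y) X"
      by (rule dir_deriv_cong_open[OF S linear_scale[OF linear_dir_deriv[OF smooth_on_differentiable[OF sm]]]])
    then show "dir_deriv v (dir_deriv (r *\<^sub>R a) U) X = r *\<^sub>R dir_deriv v (dir_deriv a U) X"
      by (simp add: dir_deriv_linear_apply[OF bounded_linear_scaleR_right diff])
  qed
qed

lemma open_lightcone_vimage: "open S \<Longrightarrow> open {x. lightcone x \<in> S}"
  using open_vimage[OF _ smooth_on_continuous[OF smooth_lightcone], of S] by (simp add: vimage_def)

lemma differentiable_lightcone: "lightcone differentiable (at x)"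
  using has_derivative_lightcone unfolding differentiable_def by blast

lemma dir_deriv_along_lightcone:
  assumes "U differentiable (at (lightcone y))"
  shows "dir_deriv v (\<lambda>x. U (lightcone x)) y = dir_deriv (lightcone_deriv v y) U (lightcone y)"
  using dir_deriv_compose(1)[OF differentiable_lightcone assms] by (simp add: dir_deriv_lightcone)

text \<open>
  The curve \<open>t \<mapsto> \<xi>(x + tb)\<close> has velocity \<open>\<partial>\<^sub>b\<xi>\<close> and constant acceleration \<open>2|b|\<^sup>2\<eta>\<close>; the second term comes
  from the acceleration.
\<close>

lemma second_dir_deriv_along_lightcone:
  fixes U :: "'a::euclidean_space lorentz \<Rightarrow> complex"
  assumes S: "open S" "lightcone x \<in> S" and sm: "smooth_on S U"
  shows "dir_deriv b (dir_deriv b (\<lambda>x. U (lightcone x))) x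
     = dir_deriv (lightcone_deriv b x) (dir_deriv (lightcone_deriv b x) U) (lightcone x)
       + 2 * of_real (b \<bullet> b) * dir_deriv infinity_ray U (lightcone x)"
proof -
  let ?T = "{x. lightcone x \<in> S}"
  define L where "L y = 2 * ((y - x) \<bullet> b)" for y
  have T: "open ?T" "x \<in> ?T" using open_lightcone_vimage[OF S(1)] S(2) by auto
  \<comment> \<open>The velocity is affine in the base point, so its variable part can be split off as a scalar.\<close>
  have aff: "lightcone_deriv b y = lightcone_deriv b x + L y *\<^sub>R infinity_ray" for y
    by (simp add: lightcone_deriv_def infinity_ray_def L_def inner_diff_left)
  have 1: "dir_deriv b (\<lambda>x. U (lightcone x)) y
     = dir_deriv (lightcone_deriv b x) U (lightcone y) + L y *\<^sub>R dir_deriv infinity_ray U (lightcone y)"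
    if "y \<in> ?T" for y
  proof -
    have d: "U differentiable (at (lightcone y))" using smooth_on_differentiable[OF sm] that by simp
    show ?thesis
      unfolding dir_deriv_along_lightcone[OF d] aff[of y]
      by (simp add: linear_add[OF linear_dir_deriv[OF d]] linear_scale[OF linear_dir_deriv[OF d]])
  qed
  have dd: "dir_deriv v U differentiable (at (lightcone x))" for v
    by (rule smooth_on_differentiable[OF smooth_on_dir_deriv[OF sm] S(2)])
  have dd': "(\<lambda>y. dir_deriv v U (lightcone y)) differentiable (at x)" for v
    by (rule dir_deriv_compose(2)[OF differentiable_lightcone dd])
  have L: "(L has_derivative (\<lambda>v. 2 * (v \<bullet> b))) (at x)"
    unfolding L_def by (auto intro!: derivative_eq_intros)
  then have dL: "L differentiable (at x)" unfolding differentiable_def by blast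
  have dLU: "(\<lambda>y. L y *\<^sub>R dir_deriv infinity_ray U (lightcone y)) differentiable (at x)"
    using bounded_bilinear.FDERIV[OF bounded_bilinear_scaleR L has_derivative_dir_deriv[OF dd']]
    unfolding differentiable_def by blast
  have "dir_deriv b (dir_deriv b (\<lambda>x. U (lightcone x))) x
    = dir_deriv b (\<lambda>y. dir_deriv (lightcone_deriv b x) U (lightcone y)
        + L y *\<^sub>R dir_deriv infinity_ray U (lightcone y)) x"
    by (rule dir_deriv_cong_open[OF T 1])
  also have "\<dots> = dir_deriv b (\<lambda>y. dir_deriv (lightcone_deriv b x) U (lightcone y)) x
      + dir_deriv b (\<lambda>y. L y *\<^sub>R dir_deriv infinity_ray U (lightcone y)) x"
    by (rule dir_deriv_add[OF dd' dLU])
  also have "dir_deriv b (\<lambda>y. dir_deriv (lightcone_deriv b x) U (lightcone y)) x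
      = dir_deriv (lightcone_deriv b x) (dir_deriv (lightcone_deriv b x) U) (lightcone x)"
    by (rule dir_deriv_along_lightcone[OF dd])
  also have "dir_deriv b (\<lambda>y. L y *\<^sub>R dir_deriv infinity_ray U (lightcone y)) x
      = 2 * of_real (b \<bullet> b) * dir_deriv infinity_ray U (lightcone x)"
    unfolding dir_deriv_bilinear[OF bounded_bilinear_scaleR dL dd'] dir_derivI[OF L]
    by (simp add: L_def scaleR_conv_of_real)
  finally show ?thesis .
qed

text \<open>
  The Laplacian of \<open>U \<circ> \<xi>\<close> is the trace of \<open>D\<^sup>2U\<close> over the \<open>\<partial>\<^sub>b\<xi>\<close> plus \<open>2d \<partial>\<^sub>\<eta>U\<close>. By the frame formula this
  trace is \<open>-4\<box>U + 4 D\<^sup>2U(\<xi>,\<eta>)\<close>, and Euler's relation for \<open>\<partial>\<^sub>\<eta>U\<close>, of degree \<open>-s-1\<close>, turns the last term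
  into \<open>-4(s+1) \<partial>\<^sub>\<eta>U\<close>. All first order terms then combine to the gradient of \<open>U\<close> in direction \<open>N\<close>, with
  the coefficient \<open>s - \<rho> + 1\<close> because \<open>d = 2\<rho>\<close>.
\<close>

lemma tractor_D_ambient:
  fixes U :: "'a::euclidean_space lorentz \<Rightarrow> complex"
  assumes S: "open S" "lightcone x \<in> S" and sm: "smooth_on S U" and hom: "homogeneous_on S s U"
  shows "tractor_D s N (\<lambda>x. U (lightcone x)) x =
     - 4 * of_real (lform N (lightcone x)) * wave_op U (lightcone x)
     - 8 * (s - rho TYPE('a) + 1) * dir_deriv N U (lightcone x)"
proof -
  define X where "X = lightcone x"
  have X: "X \<in> S" using S by (simp add: X_def)
  define B where "B v w = dir_deriv v (dir_deriv w U) X" for v w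
  define D where "D v = dir_deriv v U X" for v
  define Q where "Q = (\<Sum>b\<in>Basis. B (lightcone_deriv b x) (lightcone_deriv b x))"
  define R where "R = (\<Sum>b\<in>Basis. of_real (lform N (lightcone_deriv b x)) * D (lightcone_deriv b x))"
  have bil: "bilinear B"
    unfolding B_def by (rule bilinear_second_dir_deriv[OF S(1) X sm])
  have lin: "linear D"
    unfolding D_def by (rule linear_dir_deriv[OF smooth_on_differentiable[OF sm X]])
  have "B X infinity_ray = - (s + 1) * D infinity_ray"
    unfolding B_def D_def
    by (rule euler_homogeneous[OF S(1) smooth_on_dir_deriv[OF sm] homogeneous_on_dir_deriv[OF S(1) sm hom] X])
  moreover have "B infinity_ray X = B X infinity_ray"
    unfolding B_def by (rule dir_deriv_commute[OF S(1) X sm])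
  ultimately have "wave_op U X = - (s + 1) * D infinity_ray - Q / 4"
    using wave_trace_lightcone_frame[OF bil, of x]
    unfolding wave_op_def Q_def X_def[symmetric] B_def[symmetric] by simp
  then have Q: "Q = - 4 * wave_op U X - 4 * (s + 1) * D infinity_ray"
    by (simp only:) (simp add: algebra_simps)
  have "(\<Sum>b\<in>Basis. dir_deriv b (dir_deriv b (\<lambda>x. U (lightcone x))) x)
      = (\<Sum>b\<in>Basis. B (lightcone_deriv b x) (lightcone_deriv b x) + 2 * D infinity_ray)"
    unfolding B_def D_def X_def
    by (intro sum.cong refl) (simp add: second_dir_deriv_along_lightcone[OF S sm])
  also have "\<dots> = Q + 4 * rho TYPE('a) * D infinity_ray"
    by (simp add: Q_def rho_def sum.distrib)
  finally have lap: "(\<Sum>b\<in>Basis. dir_deriv b (dir_deriv b (\<lambda>x. U (lightcone x))) x)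
      = Q + 4 * rho TYPE('a) * D infinity_ray" .
  have first: "(\<Sum>b\<in>Basis. of_real (lform N (lightcone_deriv b x)) * dir_deriv b (\<lambda>x. U (lightcone x)) x) = R"
    unfolding R_def D_def X_def
    using dir_deriv_along_lightcone[OF smooth_on_differentiable[OF sm S(2)]] by simp
  have DX: "D X = - s * U X"
    unfolding D_def by (rule euler_homogeneous[OF S(1) sm hom X])
  have "D N = D ((lform N infinity_ray / 2) *\<^sub>R X + (lform N X / 2) *\<^sub>R infinity_ray
     - (1/4) *\<^sub>R (\<Sum>b\<in>Basis. lform N (lightcone_deriv b x) *\<^sub>R lightcone_deriv b x))"
    unfolding X_def using lightcone_expansion[of N x] by simp
  also have "\<dots> = (lform N infinity_ray / 2) *\<^sub>R D X + (lform N X / 2) *\<^sub>R D infinity_ray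
     - (1/4) *\<^sub>R (\<Sum>b\<in>Basis. lform N (lightcone_deriv b x) *\<^sub>R D (lightcone_deriv b x))"
    by (simp only: linear_diff[OF lin] linear_add[OF lin] linear_scale[OF lin] linear_sum[OF lin])
  also have "\<dots> = of_real (lform N infinity_ray) / 2 * (- s * U X)
     + of_real (lform N X) / 2 * D infinity_ray - R / 4"
    unfolding R_def DX by (simp add: scaleR_conv_of_real)
  finally have DN: "D N = of_real (lform N infinity_ray) / 2 * (- s * U X)
     + of_real (lform N X) / 2 * D infinity_ray - R / 4" .
  show ?thesis
    unfolding tractor_D_def lap first X_def[symmetric] D_def[symmetric] DN Q
    by (simp add: algebra_simps)
qed

subsection \<open>Covariance of the tractor D operator\<close>

text \<open>
  The representation \<open>\<pi>\<^sub>\<lambda>(h\<^sup>-\<^sup>1)\<close> with \<open>s = \<rho> + \<lambda>\<close>, on the set where \<open>conf_den h\<close> is positive.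
\<close>

definition conf_pull :: "('a::euclidean_space lorentz \<Rightarrow> 'a lorentz) \<Rightarrow> complex \<Rightarrow> ('a \<Rightarrow> complex) \<Rightarrow> 'a \<Rightarrow> complex" where
  "conf_pull h s u x = of_real (conf_den h x) powr (- s) * u (act h x)"

text \<open>
  The homogeneous extension of \<open>u\<close> that is constant up to scaling along the fibres of \<open>cone_point\<close>.
\<close>

definition cone_extend :: "complex \<Rightarrow> ('a::euclidean_space \<Rightarrow> complex) \<Rightarrow> 'a lorentz \<Rightarrow> complex" where
  "cone_extend s u X = of_real (cone_height X) powr (- s) * u (cone_point X)"

lemma linear_cone_height: "bounded_linear cone_height"
  unfolding cone_height_def
  by (simp add: linear_conv_bounded_linear[symmetric]) (rule linearI; simp add: field_simps)

lemma open_cone_height: "open {X. cone_height X > 0}"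
proof -
  have "continuous_on UNIV cone_height"
    using linear_cone_height bounded_linear.continuous_on continuous_on_id by blast
  then show ?thesis by (intro open_Collect_less) auto
qed

lemma smooth_cone_point: "smooth_on {X. cone_height X > 0} cone_point"
proof -
  have h: "smooth_on {X. cone_height X > 0} (\<lambda>X. 2 * cone_height X)"
    by (intro smooth_on_mult open_cone_height smooth_on_const smooth_on_bounded_linear linear_cone_height)
  have "smooth_on {X. cone_height X > 0} (\<lambda>X. inverse (2 * cone_height X))"
    by (rule smooth_on_compose[OF open_cone_height _ h _ smooth_on_inverse_pos]) auto
  then show ?thesis
    unfolding cone_point_def
    by (rule smooth_on_scaleR[OF open_cone_height _ smooth_on_bounded_linear[OF
        bounded_linear_compose[OF bounded_linear_fst bounded_linear_snd]]])
qed

lemma smooth_cone_extend: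
  assumes "smooth u" shows "smooth_on {X. cone_height X > 0} (cone_extend s u)"
proof -
  have 1: "smooth_on {X. cone_height X > 0} (\<lambda>X. complex_of_real (cone_height X) powr (- s))"
    by (rule smooth_on_compose[OF open_cone_height _ smooth_on_bounded_linear[OF linear_cone_height]
          _ smooth_on_powr_pos]) auto
  have 2: "smooth_on {X. cone_height X > 0} (\<lambda>X. u (cone_point X))"
    by (rule smooth_on_compose[OF open_cone_height open_UNIV smooth_cone_point])
      (use assms in \<open>simp_all add: smooth_on_UNIV\<close>)
  show ?thesis
    unfolding cone_extend_def by (rule smooth_on_mult[OF open_cone_height 1 2])
qed

lemma homogeneous_cone_extend: "homogeneous_on {X. cone_height X > 0} s (cone_extend s u)"
  unfolding homogeneous_on_def
proof (intro ballI allI impI conjI)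
  fix X :: "'a lorentz" and r :: real assume X: "X \<in> {X. cone_height X > 0}" and r: "r > 0"
  show "r *\<^sub>R X \<in> {X. cone_height X > 0}" using X r by (simp add: cone_scaleR)
  have "complex_of_real (r * cone_height X) powr (- s) = of_real r powr (- s) * of_real (cone_height X) powr (- s)"
    using X r unfolding of_real_mult by (intro powr_times_real) auto
  then show "cone_extend s u (r *\<^sub>R X) = of_real r powr (- s) * cone_extend s u X"
    using r unfolding cone_extend_def by (simp only: cone_scaleR) (simp add: cone_scaleR)
qed

lemma conf_pull_eq_cone_extend:
  "lorentz_linear h \<Longrightarrow> conf_pull h s u = (\<lambda>x. cone_extend s u (h (lightcone x)))"
  by (rule ext) (simp add: conf_pull_def cone_extend_def conf_den_def act_eq_cone_point)

lemma lorentz_linear_bounded: "lorentz_linear h \<Longrightarrow> bounded_linear h"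
  using lorentz_linearD(1) linear_conv_bounded_linear by blast

lemma dir_deriv_linear_substitution:
  assumes "bounded_linear h" "U differentiable (at (h X))"
  shows "dir_deriv v (\<lambda>X. U (h X)) X = dir_deriv (h v) U (h X)"
proof -
  have d: "(h has_derivative h) (at X)" using assms(1) bounded_linear_imp_has_derivative by blast
  then have "h differentiable (at X)" unfolding differentiable_def by blast
  from dir_deriv_compose(1)[OF this assms(2)] show ?thesis by (simp add: dir_derivI[OF d])
qed

lemma wave_op_invariant:
  assumes h: "lorentz_linear h" and S: "open S" "h X \<in> S" and sm: "smooth_on S U"
  shows "wave_op (\<lambda>X. U (h X)) X = wave_op U (h X)"
proof -
  note bl = lorentz_linear_bounded[OF h]
  have T: "open (h -` S)" "X \<in> h -` S"
    using S bounded_linear.continuous_on[OF bl continuous_on_id] by (auto intro: open_vimage)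
  have "dir_deriv v (dir_deriv w (\<lambda>X. U (h X))) X = dir_deriv (h v) (dir_deriv (h w) U) (h X)" for v w
  proof -
    have "dir_deriv v (dir_deriv w (\<lambda>X. U (h X))) X = dir_deriv v (\<lambda>X. dir_deriv (h w) U (h X)) X"
      by (rule dir_deriv_cong_open[OF T])
        (simp add: dir_deriv_linear_substitution[OF bl smooth_on_differentiable[OF sm]])
    also have "\<dots> = dir_deriv (h v) (dir_deriv (h w) U) (h X)"
      by (rule dir_deriv_linear_substitution[OF bl
            smooth_on_differentiable[OF smooth_on_dir_deriv[OF sm] S(2)]])
    finally show ?thesis .
  qed
  then show ?thesis
    unfolding wave_op_def using wave_trace_invariant[OF bilinear_second_dir_deriv[OF S sm] h] by simp
qed

lemma homogeneous_wave_op: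
  assumes S: "open S" and sm: "smooth_on S U" and hom: "homogeneous_on S s U"
    and X: "X \<in> S" and r: "r > 0"
  shows "wave_op U (r *\<^sub>R X) = of_real r powr (- (s + 2)) * wave_op U X"
proof -
  have "dir_deriv v (dir_deriv w U) (r *\<^sub>R X) = of_real r powr (- (s + 2)) * dir_deriv v (dir_deriv w U) X" for v w
    using homogeneous_on_dir_deriv[OF S smooth_on_dir_deriv[OF sm] homogeneous_on_dir_deriv[OF S sm hom], of v w] X r
    unfolding homogeneous_on_def by (simp add: add.assoc)
  then show ?thesis
    unfolding wave_op_def wave_trace_def by (simp add: sum_distrib_left)
qed

text \<open>
  With the homogeneous extension \<open>U\<close> of \<open>u\<close>, both sides are values of the ambient formula: at \<open>\<xi>(x)\<close> for
  \<open>U \<circ> h\<close>, and at \<open>\<xi>(h(x))\<close> for \<open>U\<close>. The ambient formula is natural under \<open>h\<close>, and \<open>h \<xi>(x)\<close> is the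
  multiple \<open>c \<xi>(h(x))\<close>; homogeneity of the derivatives of \<open>U\<close> contributes the power of \<open>c\<close>. The wave
  operator lowers the degree by \<open>2\<close>, but its coefficient \<open>\<langle>N, \<xi>(x)\<rangle>\<close> gives back one factor \<open>c\<close>.
\<close>

lemma tractor_D_covariant:
  fixes u :: "'a::euclidean_space \<Rightarrow> complex"
  assumes h: "lorentz_linear h" and u: "smooth u" and c: "conf_den h x > 0"
  shows "tractor_D s N (conf_pull h s u) x
     = of_real (conf_den h x) powr (- (s + 1)) * tractor_D s (h N) u (act h x)"
proof -
  define c where "c = conf_den h x"
  define Y where "Y = lightcone (act h x)"
  define U where "U = cone_extend s u"
  let ?S = "{X :: 'a lorentz. cone_height X > 0}"
  have cpos: "c > 0" using assms by (simp add: c_def)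
  have sm: "smooth_on ?S U" unfolding U_def by (rule smooth_cone_extend[OF u])
  have hom: "homogeneous_on ?S s U" unfolding U_def by (rule homogeneous_cone_extend)
  note bl = lorentz_linear_bounded[OF h]
  have hX: "h (lightcone x) = c *\<^sub>R Y"
    unfolding c_def Y_def using lorentz_lightcone_act[OF h] c by simp
  have Y: "Y \<in> ?S" by (simp add: Y_def)
  have inS: "h (lightcone x) \<in> ?S" unfolding hX using cpos by (simp add: cone_scaleR Y_def)
  have T: "open (h -` ?S)"
    by (rule open_vimage[OF open_cone_height bounded_linear.continuous_on[OF bl continuous_on_id]])
  have smV: "smooth_on (h -` ?S) (\<lambda>X. U (h X))"
    by (rule smooth_on_compose[OF T open_cone_height smooth_on_bounded_linear[OF bl] _ sm]) auto
  have homV: "homogeneous_on (h -` ?S) s (\<lambda>X. U (h X))"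
    unfolding homogeneous_on_def
    by (simp only: linear_scale[OF lorentz_linearD(1)[OF h]] vimage_eq)
      (use hom in \<open>unfold homogeneous_on_def, blast\<close>)
  have U: "(\<lambda>x. U (lightcone x)) = u"
    by (rule ext) (simp add: U_def cone_extend_def)
  have DU: "dir_deriv (h N) U (c *\<^sub>R Y) = of_real c powr (- (s + 1)) * dir_deriv (h N) U Y"
    using homogeneous_on_dir_deriv[OF open_cone_height sm hom, of "h N"] Y cpos
    unfolding homogeneous_on_def by blast
  have form: "lform N (lightcone x) = c * lform (h N) Y"
    using lorentz_linearD(3)[OF h, of N "lightcone x"] unfolding hX by (simp add: lform_simps)
  have pw: "complex_of_real c * of_real c powr (- (s + 2)) = of_real c powr (- (s + 1))"
  proof -
    have e: "1 + - (s + 2) = - (s + 1)" by simp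
    show ?thesis using cpos powr_add[of "complex_of_real c" 1 "- (s + 2)"] unfolding e by simp
  qed
  have "tractor_D s N (conf_pull h s u) x = tractor_D s N (\<lambda>x. U (h (lightcone x))) x"
    unfolding conf_pull_eq_cone_extend[OF h] U_def ..
  also have "\<dots> = - 4 * of_real (lform N (lightcone x)) * wave_op (\<lambda>X. U (h X)) (lightcone x)
     - 8 * (s - rho TYPE('a) + 1) * dir_deriv N (\<lambda>X. U (h X)) (lightcone x)"
    using inS by (intro tractor_D_ambient[OF T _ smV homV]) simp
  also have "wave_op (\<lambda>X. U (h X)) (lightcone x) = of_real c powr (- (s + 2)) * wave_op U Y"
    unfolding wave_op_invariant[OF h open_cone_height inS sm] hX
    by (rule homogeneous_wave_op[OF open_cone_height sm hom Y cpos])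
  also have "dir_deriv N (\<lambda>X. U (h X)) (lightcone x) = of_real c powr (- (s + 1)) * dir_deriv (h N) U Y"
    unfolding dir_deriv_linear_substitution[OF bl smooth_on_differentiable[OF sm inS]] hX DU ..
  also have "- 4 * of_real (lform N (lightcone x)) * (of_real c powr (- (s + 2)) * wave_op U Y)
     - 8 * (s - rho TYPE('a) + 1) * (of_real c powr (- (s + 1)) * dir_deriv (h N) U Y)
     = of_real c powr (- (s + 1)) * (- 4 * of_real (lform (h N) Y) * wave_op U Y
     - 8 * (s - rho TYPE('a) + 1) * dir_deriv (h N) U Y)"
    unfolding form of_real_mult pw[symmetric] by (simp add: algebra_simps)
  also have "\<dots> = of_real c powr (- (s + 1)) * tractor_D s (h N) (\<lambda>x. U (lightcone x)) (act h x)"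
    using tractor_D_ambient[OF open_cone_height _ sm hom, of "act h x" "h N"] Y
    unfolding Y_def by simp
  finally show ?thesis unfolding U c_def .
qed

section \<open>The operator F as a contraction of two tractor D operators\<close>

lemma linear_tractor_D:
  fixes u :: "'a::euclidean_space \<Rightarrow> complex"
  shows "linear (\<lambda>N. tractor_D s N u x)"
proof (rule linearI)
  fix M N :: "'a lorentz" and r :: real
  define a where "a = 2 * (s - rho TYPE('a) + 1)"
  define a' where "a' = 4 * (s - rho TYPE('a) + 1) * s"
  show "tractor_D s (M + N) u x = tractor_D s M u x + tractor_D s N u x"
    unfolding tractor_D_def a_def[symmetric] a'_def[symmetric] lform_simps of_real_add
    by (simp add: sum.distrib algebra_simps)
  show "tractor_D s (r *\<^sub>R N) u x = r *\<^sub>R tractor_D s N u x"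
    unfolding tractor_D_def a_def[symmetric] a'_def[symmetric] lform_simps of_real_mult scaleR_conv_of_real
    by (simp add: sum_distrib_left algebra_simps)
qed

lemma tractor_D_cong_open:
  assumes O: "open S" "x \<in> S" and eq: "\<And>y. y \<in> S \<Longrightarrow> u y = v y"
  shows "tractor_D s N u x = tractor_D s N v x"
proof -
  have 1: "dir_deriv b u y = dir_deriv b v y" if "y \<in> S" for b y
    by (rule dir_deriv_cong_open[OF O(1) that eq])
  have "dir_deriv b (dir_deriv b u) x = dir_deriv b (dir_deriv b v) x" for b
    by (rule dir_deriv_cong_open[OF O 1])
  then show ?thesis unfolding tractor_D_def using 1[OF O(2)] eq[OF O(2)] by simp
qed

lemma tractor_D_add:
  assumes S: "open S" "x \<in> S" and u: "smooth_on S u" and v: "smooth_on S v"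
  shows "tractor_D s N (\<lambda>y. u y + v y) x = tractor_D s N u x + tractor_D s N v x"
proof -
  have 1: "dir_deriv b (\<lambda>y. u y + v y) y = dir_deriv b u y + dir_deriv b v y" if "y \<in> S" for b y
    by (rule dir_deriv_add[OF smooth_on_differentiable[OF u that] smooth_on_differentiable[OF v that]])
  have "dir_deriv b (dir_deriv b (\<lambda>y. u y + v y)) x = dir_deriv b (dir_deriv b u) x + dir_deriv b (dir_deriv b v) x" for b
    using dir_deriv_cong_open[OF S 1] dir_deriv_add[OF smooth_on_differentiable[OF smooth_on_dir_deriv[OF u] S(2)]
        smooth_on_differentiable[OF smooth_on_dir_deriv[OF v] S(2)]] by simp
  then show ?thesis
    unfolding tractor_D_def by (simp add: 1[OF S(2)] sum.distrib algebra_simps)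
qed

lemma tractor_D_cmult:
  fixes u :: "'a::euclidean_space \<Rightarrow> complex"
  assumes S: "open S" "x \<in> S" and u: "smooth_on S u"
  shows "tractor_D s N (\<lambda>y. c * u y) x = c * tractor_D s N u x"
proof -
  define a where "a = 2 * (s - rho TYPE('a) + 1)"
  define a' where "a' = 4 * (s - rho TYPE('a) + 1) * s"
  have 1: "dir_deriv b (\<lambda>y. c * u y) y = c * dir_deriv b u y" if "y \<in> S" for b y
    by (rule dir_deriv_cmult[OF smooth_on_differentiable[OF u that]])
  have "dir_deriv b (dir_deriv b (\<lambda>y. c * u y)) x = c * dir_deriv b (dir_deriv b u) x" for b
    using dir_deriv_cong_open[OF S 1] dir_deriv_cmult[OF smooth_on_differentiable[OF smooth_on_dir_deriv[OF u] S(2)]]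
    by simp
  then show ?thesis
    unfolding tractor_D_def a_def[symmetric] a'_def[symmetric]
    by (simp add: 1[OF S(2)] sum_distrib_left algebra_simps)
qed

lemma tractor_D_sum:
  assumes S: "open S" "x \<in> S" and u: "\<And>i. i \<in> I \<Longrightarrow> smooth_on S (u i)"
  shows "tractor_D s N (\<lambda>y. \<Sum>i\<in>I. u i y) x = (\<Sum>i\<in>I. tractor_D s N (u i) x)"
  using u
proof (induction I rule: infinite_finite_induct)
  case (insert i I)
  then show ?case
    using tractor_D_add[OF S, of "u i" "\<lambda>y. \<Sum>i\<in>I. u i y" s N] smooth_on_sum[OF S(1), of I u] by simp
qed (simp_all add: tractor_D_def)

subsection \<open>Functions of two points with one point fixed\<close>

lemma has_derivative_slice:
  "((\<lambda>y. (y, z)) has_derivative (\<lambda>v. (v, 0))) (at y)"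
  "((\<lambda>z. (y, z)) has_derivative (\<lambda>v. (0, v))) (at z)"
  by (auto intro!: derivative_eq_intros)

lemma dir_deriv_slice:
  assumes "f differentiable (at (y, z))"
  shows "dir_deriv b (\<lambda>y. f (y, z)) y = d_y b f (y, z)"
    and "dir_deriv b (\<lambda>z. f (y, z)) z = d_z b f (y, z)"
proof -
  have 1: "(\<lambda>y. (y, z)) differentiable (at y)" "(\<lambda>z. (y, z)) differentiable (at z)"
    using has_derivative_slice unfolding differentiable_def by blast+
  show "dir_deriv b (\<lambda>y. f (y, z)) y = d_y b f (y, z)"
    unfolding d_y_def dir_deriv_compose(1)[OF 1(1) assms] dir_derivI[OF has_derivative_slice(1)] ..
  show "dir_deriv b (\<lambda>z. f (y, z)) z = d_z b f (y, z)"
    unfolding d_z_def dir_deriv_compose(1)[OF 1(2) assms] dir_derivI[OF has_derivative_slice(2)] ..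
qed

lemma open_slice:
  assumes "open W" shows "open {y. (y, z) \<in> W}" "open {z. (y, z) \<in> W}"
proof -
  have "continuous_on UNIV (\<lambda>y. (y, z))" "continuous_on UNIV (\<lambda>z. (y, z))"
    by (intro continuous_intros)+
  from open_vimage[OF assms this(1)] open_vimage[OF assms this(2)]
  show "open {y. (y, z) \<in> W}" "open {z. (y, z) \<in> W}" by (simp_all add: vimage_def)
qed

lemma smooth_on_Pair:
  assumes S: "open S" and "smooth_on S f" "smooth_on S g"
  shows "smooth_on S (\<lambda>x. (f x, g x))"
proof -
  have "bounded_linear (\<lambda>a::'b. (a, 0::'c))" "bounded_linear (\<lambda>a::'c. (0::'b, a))"
    by (intro bounded_linear_Pair bounded_linear_ident bounded_linear_zero)+
  from smooth_on_add[OF S smooth_on_linear_apply[OF S this(1) assms(2)]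
      smooth_on_linear_apply[OF S this(2) assms(3)]]
  show ?thesis by simp
qed

lemma smooth_on_ident: "smooth_on S (\<lambda>x. x)"
  by (rule smooth_on_bounded_linear[OF bounded_linear_ident])

lemma smooth_on_slice:
  fixes f :: "'a::euclidean_space \<times> 'a \<Rightarrow> complex"
  assumes W: "open W" and f: "smooth_on W f"
  shows "smooth_on {y. (y, z) \<in> W} (\<lambda>y. f (y, z))" "smooth_on {z. (y, z) \<in> W} (\<lambda>z. f (y, z))"
proof -
  show "smooth_on {y. (y, z) \<in> W} (\<lambda>y. f (y, z))"
    by (rule smooth_on_compose[OF open_slice(1)[OF W] W
          smooth_on_Pair[OF open_slice(1)[OF W] smooth_on_ident smooth_on_const] _ f]) auto
  show "smooth_on {z. (y, z) \<in> W} (\<lambda>z. f (y, z))"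
    by (rule smooth_on_compose[OF open_slice(2)[OF W] W
          smooth_on_Pair[OF open_slice(2)[OF W] smooth_on_const smooth_on_ident] _ f]) auto
qed

lemma tractor_D_slice:
  fixes f :: "'a::euclidean_space \<times> 'a \<Rightarrow> complex"
  assumes W: "open W" and p: "(y, z) \<in> W" and f: "smooth_on W f"
  shows "tractor_D s N (\<lambda>y. f (y, z)) y =
       of_real (lform N (lightcone y)) * laplace_y f (y, z)
     + 2 * (s - rho TYPE('a) + 1) * (\<Sum>b\<in>Basis. of_real (lform N (lightcone_deriv b y)) * d_y b f (y, z))
     + 4 * (s - rho TYPE('a) + 1) * s * of_real (lform N infinity_ray) * f (y, z)"
  and "tractor_D s N (\<lambda>z. f (y, z)) z =
       of_real (lform N (lightcone z)) * laplace_z f (y, z)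
     + 2 * (s - rho TYPE('a) + 1) * (\<Sum>b\<in>Basis. of_real (lform N (lightcone_deriv b z)) * d_z b f (y, z))
     + 4 * (s - rho TYPE('a) + 1) * s * of_real (lform N infinity_ray) * f (y, z)"
proof -
  have d: "f differentiable (at q)" "d_y b f differentiable (at q)" "d_z b f differentiable (at q)"
    if "q \<in> W" for q b
    using smooth_on_differentiable[OF f that] smooth_on_differentiable[OF smooth_on_dir_deriv[OF f] that]
    unfolding d_y_def d_z_def by blast+
  have "dir_deriv b (dir_deriv b (\<lambda>y. f (y, z))) y = dir_deriv b (\<lambda>y. d_y b f (y, z)) y" for b
    using p by (intro dir_deriv_cong_open[OF open_slice(1)[OF W, of z]]) (auto intro: dir_deriv_slice d)
  then have "dir_deriv b (dir_deriv b (\<lambda>y. f (y, z))) y = d_y b (d_y b f) (y, z)" for b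
    by (simp add: dir_deriv_slice(1)[OF d(2)[OF p]])
  then show "tractor_D s N (\<lambda>y. f (y, z)) y =
       of_real (lform N (lightcone y)) * laplace_y f (y, z)
     + 2 * (s - rho TYPE('a) + 1) * (\<Sum>b\<in>Basis. of_real (lform N (lightcone_deriv b y)) * d_y b f (y, z))
     + 4 * (s - rho TYPE('a) + 1) * s * of_real (lform N infinity_ray) * f (y, z)"
    unfolding tractor_D_def laplace_y_def by (simp add: dir_deriv_slice(1)[OF d(1)[OF p]])
  have "dir_deriv b (dir_deriv b (\<lambda>z. f (y, z))) z = dir_deriv b (\<lambda>z. d_z b f (y, z)) z" for b
    using p by (intro dir_deriv_cong_open[OF open_slice(2)[OF W, of y]]) (auto intro: dir_deriv_slice d)
  then have "dir_deriv b (dir_deriv b (\<lambda>z. f (y, z))) z = d_z b (d_z b f) (y, z)" for b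
    by (simp add: dir_deriv_slice(2)[OF d(3)[OF p]])
  then show "tractor_D s N (\<lambda>z. f (y, z)) z =
       of_real (lform N (lightcone z)) * laplace_z f (y, z)
     + 2 * (s - rho TYPE('a) + 1) * (\<Sum>b\<in>Basis. of_real (lform N (lightcone_deriv b z)) * d_z b f (y, z))
     + 4 * (s - rho TYPE('a) + 1) * s * of_real (lform N infinity_ray) * f (y, z)"
    unfolding tractor_D_def laplace_z_def by (simp add: dir_deriv_slice(2)[OF d(1)[OF p]])
qed

lemma smooth_partial:
  assumes "open W" "smooth_on W f"
  shows "smooth_on W (d_y b f)" "smooth_on W (d_z b f)" "smooth_on W (laplace_y f)" "smooth_on W (laplace_z f)"
  unfolding d_y_def d_z_def laplace_y_def laplace_z_def
  using assms by (auto intro!: smooth_on_sum smooth_on_dir_deriv)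

lemma d_z_laplace_y_commute:
  fixes f :: "'a::euclidean_space \<times> 'a \<Rightarrow> complex"
  assumes W: "open W" "p \<in> W" and f: "smooth_on W f"
  shows "d_z c (laplace_y f) p = laplace_y (d_z c f) p"
proof -
  have comm: "d_z c (d_y b g) q = d_y b (d_z c g) q" if "q \<in> W" "smooth_on W g" for q b and g :: "'a \<times> 'a \<Rightarrow> complex"
    unfolding d_y_def d_z_def by (rule dir_deriv_commute[OF W(1) that])
  note sm = smooth_partial[OF W(1)]
  have fin: "d_z c (\<lambda>q. \<Sum>b\<in>I. d_y b (d_y b f) q) p = (\<Sum>b\<in>I. d_z c (d_y b (d_y b f)) p)" if "finite I" for I
    using that
  proof (induction I)
    case (insert b I)
    have "d_z c (\<lambda>q. d_y b (d_y b f) q + (\<Sum>b\<in>I. d_y b (d_y b f) q)) p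
      = d_z c (d_y b (d_y b f)) p + d_z c (\<lambda>q. \<Sum>b\<in>I. d_y b (d_y b f) q) p"
      unfolding d_z_def
      by (rule dir_deriv_add; rule smooth_on_differentiable[OF _ W(2)])
        (intro sm f smooth_on_sum W)+
    then show ?case using insert by simp
  qed (simp add: d_z_def)
  have "d_z c (d_y b (d_y b f)) p = d_y b (d_y b (d_z c f)) p" for b
  proof -
    have "d_z c (d_y b (d_y b f)) p = d_y b (d_z c (d_y b f)) p"
      by (rule comm[OF W(2) sm(1)[OF f]])
    also have "\<dots> = d_y b (d_y b (d_z c f)) p"
      unfolding d_y_def by (rule dir_deriv_cong_open[OF W]) (rule comm[unfolded d_y_def, OF _ f])
    finally show ?thesis .
  qed
  then show ?thesis unfolding laplace_y_def fin[OF finite_Basis] by simp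
qed

subsection \<open>The Lorentz contraction\<close>

text \<open>
  \<open>V\<close> is the sum of \<open>\<epsilon>\<^sub>A \<langle>A, V\<rangle> A\<close> over the basis. Hence, when the operator acting in \<open>z\<close> is expanded with
  coefficients \<open>\<langle>N, V\<rangle>\<close>, contraction over \<open>N\<close> puts \<open>V\<close> into the operator acting in \<open>y\<close>.
\<close>

lemma wave_trace_contract_right:
  assumes T: "linear T"
  shows "wave_trace (\<lambda>v w. of_real (lform w V) * T v) = T V"
proof -
  have "T V = T (\<Sum>A\<in>Basis. (V \<bullet> A) *\<^sub>R A)" by (simp add: euclidean_representation)
  also have "\<dots> = (\<Sum>A\<in>Basis. (V \<bullet> A) *\<^sub>R T A)"
    by (simp only: linear_sum[OF T] linear_scale[OF T])
  also have "\<dots> = wave_trace (\<lambda>v w. of_real (lform w V) * T v)"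
    unfolding wave_trace_def
  proof (rule sum.cong[OF refl])
    fix A :: "'a lorentz" assume A: "A \<in> Basis"
    have "lform A A * lform A V = (lform A A * lform A A) * (V \<bullet> A)"
      using lform_Basis(1)[OF A, of V] lform_commute[of A V] by simp
    then have "V \<bullet> A = lform A A * lform A V"
      using lform_Basis(2)[OF A] by (simp only: mult_1)
    then show "(V \<bullet> A) *\<^sub>R T A = lform A A *\<^sub>R (of_real (lform A V) * T A)"
      by (simp add: scaleR_conv_of_real)
  qed
  finally show ?thesis by simp
qed

lemma wave_trace_add: "wave_trace (\<lambda>v w. B v w + C v w) = wave_trace B + wave_trace C"
  by (simp add: wave_trace_def scaleR_right_distrib sum.distrib)

lemma wave_trace_cmult: "wave_trace (\<lambda>v w. c * B v w) = c * wave_trace B"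
  by (simp add: wave_trace_def sum_distrib_left)

lemma wave_trace_sum: "wave_trace (\<lambda>v w. \<Sum>i\<in>I. B i v w) = (\<Sum>i\<in>I. wave_trace (B i))"
  unfolding wave_trace_def scaleR_sum_right by (rule sum.swap)

definition tractor_pair ::
  "complex \<Rightarrow> complex \<Rightarrow> ('a::euclidean_space \<times> 'a \<Rightarrow> complex) \<Rightarrow> 'a \<times> 'a \<Rightarrow> 'a lorentz \<Rightarrow> 'a lorentz \<Rightarrow> complex" where
  "tractor_pair s t f p M N = tractor_D s M (\<lambda>y. tractor_D t N (\<lambda>z. f (y, z)) (snd p)) (fst p)"

lemma tractor_pair_expand:
  fixes f :: "'a::euclidean_space \<times> 'a \<Rightarrow> complex"
  assumes W: "open W" "(y, z) \<in> W" and f: "smooth_on W f"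
  shows "tractor_pair s t f (y, z) M N =
     of_real (lform N (lightcone z)) * tractor_D s M (\<lambda>y. laplace_z f (y, z)) y
   + 2 * (t - rho TYPE('a) + 1) *
       (\<Sum>b\<in>Basis. of_real (lform N (lightcone_deriv b z)) * tractor_D s M (\<lambda>y. d_z b f (y, z)) y)
   + 4 * (t - rho TYPE('a) + 1) * t * (of_real (lform N infinity_ray) * tractor_D s M (\<lambda>y. f (y, z)) y)"
proof -
  let ?S = "{y. (y, z) \<in> W}"
  have S: "open ?S" "y \<in> ?S" using open_slice(1)[OF W(1)] W(2) by auto
  have sm: "smooth_on ?S (\<lambda>y. laplace_z f (y, z))" "\<And>b. smooth_on ?S (\<lambda>y. d_z b f (y, z))"
      "smooth_on ?S (\<lambda>y. f (y, z))"
    using smooth_on_slice(1)[OF W(1)] smooth_partial[OF W(1) f] f by blast+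
  have cm: "smooth_on ?S (\<lambda>y. c * u y)" if "smooth_on ?S u" for c and u :: "'a \<Rightarrow> complex"
    by (rule smooth_on_mult[OF S(1) smooth_on_const that])
  define c1 where "c1 = 2 * (t - rho TYPE('a) + 1)"
  define c2 where "c2 = 4 * (t - rho TYPE('a) + 1) * t * of_real (lform N infinity_ray)"
  have "tractor_pair s t f (y, z) M N = tractor_D s M (\<lambda>y.
       of_real (lform N (lightcone z)) * laplace_z f (y, z)
     + c1 * (\<Sum>b\<in>Basis. of_real (lform N (lightcone_deriv b z)) * d_z b f (y, z))
     + c2 * f (y, z)) y"
    unfolding tractor_pair_def fst_conv snd_conv c1_def c2_def
    by (rule tractor_D_cong_open[OF S]) (use tractor_D_slice(2)[OF W(1) _ f] in simp)
  also have "\<dots> = of_real (lform N (lightcone z)) * tractor_D s M (\<lambda>y. laplace_z f (y, z)) y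
     + c1 * (\<Sum>b\<in>Basis. of_real (lform N (lightcone_deriv b z)) * tractor_D s M (\<lambda>y. d_z b f (y, z)) y)
     + c2 * tractor_D s M (\<lambda>y. f (y, z)) y"
    by (simp add: tractor_D_add[OF S] tractor_D_cmult[OF S] tractor_D_sum[OF S] cm sm
        smooth_on_add[OF S(1)] smooth_on_sum[OF S(1)])
  finally show ?thesis unfolding c1_def c2_def by (simp add: mult.assoc)
qed

lemma bilinear_tractor_pair:
  fixes f :: "'a::euclidean_space \<times> 'a \<Rightarrow> complex"
  assumes W: "open W" "(y, z) \<in> W" and f: "smooth_on W f"
  shows "bilinear (tractor_pair s t f (y, z))"
  unfolding bilinear_def
proof (intro conjI allI)
  show "linear (\<lambda>M. tractor_pair s t f (y, z) M N)" for N
    unfolding tractor_pair_def by (rule linear_tractor_D)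
  show "linear (tractor_pair s t f (y, z) M)" for M
  proof (rule linearI)
    fix N N'
    show "tractor_pair s t f (y, z) M (N + N') = tractor_pair s t f (y, z) M N + tractor_pair s t f (y, z) M N'"
      unfolding tractor_pair_expand[OF W f] lform_simps of_real_add
      by (simp add: sum.distrib algebra_simps)
  next
    fix r :: real and N
    show "tractor_pair s t f (y, z) M (r *\<^sub>R N) = r *\<^sub>R tractor_pair s t f (y, z) M N"
      unfolding tractor_pair_expand[OF W f] lform_simps of_real_mult scaleR_conv_of_real
      by (simp add: sum_distrib_left algebra_simps)
  qed
qed

text \<open>
  The operator in \<open>z\<close> contributes the vectors \<open>\<xi>(z)\<close>, \<open>\<partial>\<^sub>b\<xi>(z)\<close> and \<open>\<eta>\<close>, which the contraction inserts into the
  operator in \<open>y\<close>. The scalar products \<open>\<langle>\<xi>(z),\<xi>(y)\<rangle> = 2|y-z|\<^sup>2\<close>, \<open>\<langle>\<partial>\<^sub>b\<xi>(y),\<xi>(z)\<rangle> = 4(y-z)\<^sub>b\<close>,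
  \<open>\<langle>\<partial>\<^sub>b\<xi>(y),\<partial>\<^sub>c\<xi>(z)\<rangle> = -4\<delta>\<^bsub>bc\<^esub>\<close>, \<open>\<langle>\<eta>,\<xi>\<rangle> = 2\<close> and \<open>\<langle>\<eta>,\<partial>\<^sub>b\<xi>\<rangle> = \<langle>\<eta>,\<eta>\<rangle> = 0\<close> reproduce twice the coefficients of \<open>F\<close>.
\<close>

lemma F_op_eq_contraction:
  fixes f :: "'a::euclidean_space \<times> 'a \<Rightarrow> complex"
  assumes W: "open W" "p \<in> W" and f: "smooth_on W f"
  shows "F_op lam mu f p = wave_trace (tractor_pair (rho TYPE('a) + lam) (rho TYPE('a) + mu) f p) / 2"
proof -
  obtain y z where p: "p = (y, z)" by fastforce
  note Wp = W(2)[unfolded p]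
  define r where "r = rho TYPE('a)"
  note sm = smooth_partial[OF W(1) f]
  define T where "T M g = tractor_D (r + lam) M (\<lambda>y. g (y, z)) y" for M and g :: "'a \<times> 'a \<Rightarrow> complex"
  have lin: "linear (\<lambda>M. T M g)" for g unfolding T_def by (rule linear_tractor_D)
  have T: "T M g = of_real (lform M (lightcone y)) * laplace_y g p
     + 2 * (lam + 1) * (\<Sum>b\<in>Basis. of_real (lform M (lightcone_deriv b y)) * d_y b g p)
     + 4 * (lam + 1) * (r + lam) * of_real (lform M infinity_ray) * g p" if "smooth_on W g" for g M
    unfolding T_def p tractor_D_slice(1)[OF W(1) Wp that] r_def by simp
  have "tractor_pair (r + lam) (r + mu) f p = (\<lambda>M N.
     of_real (lform N (lightcone z)) * T M (laplace_z f)
   + 2 * (mu + 1) * (\<Sum>b\<in>Basis. of_real (lform N (lightcone_deriv b z)) * T M (d_z b f))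
   + 4 * (mu + 1) * (r + mu) * (of_real (lform N infinity_ray) * T M f))"
    unfolding p by (intro ext) (simp add: tractor_pair_expand[OF W(1) Wp f] T_def r_def)
  then have wt: "wave_trace (tractor_pair (r + lam) (r + mu) f p) =
     T (lightcone z) (laplace_z f) + 2 * (mu + 1) * (\<Sum>b\<in>Basis. T (lightcone_deriv b z) (d_z b f))
     + 4 * (mu + 1) * (r + mu) * T infinity_ray f"
    by (simp only: wave_trace_add wave_trace_cmult wave_trace_sum wave_trace_contract_right[OF lin])
  have T1: "T (lightcone z) (laplace_z f) = 2 * of_real ((norm (y - z))\<^sup>2) * laplace_y (laplace_z f) p
     + 8 * (lam + 1) * (\<Sum>b\<in>Basis. of_real (y \<bullet> b - z \<bullet> b) * d_y b (laplace_z f) p)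
     + 8 * (lam + 1) * (r + lam) * laplace_z f p"
    unfolding T[OF sm(4)] lform_lightcone norm_minus_commute[of z y]
      lform_commute[of "lightcone z" "lightcone_deriv _ y"] lform_lightcone_deriv
      lform_commute[of "lightcone z" infinity_ray]
    by (simp add: sum_distrib_left inner_diff_left algebra_simps)
  have T2: "T (lightcone_deriv c z) (d_z c f) = 4 * (of_real (z \<bullet> c - y \<bullet> c) * d_z c (laplace_y f) p)
     - 8 * (lam + 1) * d_y c (d_z c f) p" if c: "c \<in> Basis" for c
  proof -
    have "(\<Sum>b\<in>Basis. of_real (lform (lightcone_deriv c z) (lightcone_deriv b y)) * d_y b (d_z c f) p)
       = (\<Sum>b\<in>Basis. if b = c then - 4 * d_y c (d_z c f) p else 0)"
      unfolding lform_lightcone_deriv2 using c by (intro sum.cong refl) (auto simp: inner_Basis)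
    also have "\<dots> = - 4 * d_y c (d_z c f) p" using c by simp
    finally show ?thesis
      unfolding T[OF sm(2)] d_z_laplace_y_commute[OF W f] lform_lightcone_deriv
        lform_commute[of "lightcone_deriv c z" infinity_ray]
      by (simp add: inner_diff_left algebra_simps)
  qed
  have T2_sum: "(\<Sum>c\<in>Basis. T (lightcone_deriv c z) (d_z c f))
     = 4 * (\<Sum>c\<in>Basis. of_real (z \<bullet> c - y \<bullet> c) * d_z c (laplace_y f) p)
     - 8 * (lam + 1) * (\<Sum>c\<in>Basis. d_y c (d_z c f) p)"
    unfolding sum_distrib_left sum_subtractf[symmetric] by (intro sum.cong refl) (rule T2)
  have T3: "T infinity_ray f = 2 * laplace_y f p" unfolding T[OF f] by simp
  have "wave_trace (tractor_pair (r + lam) (r + mu) f p) = 2 * F_op lam mu f p"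
    unfolding wt T1 T2_sum T3 unfolding F_op_def p r_def[symmetric] prod.case
    by algebra
  then show ?thesis unfolding r_def by simp
qed

section \<open>Covariance of F under Lorentz maps\<close>

text \<open>
  The tensor product of two operators \<open>conf_pull\<close>, with \<open>s = \<rho> + \<lambda>\<close> and \<open>t = \<rho> + \<mu>\<close>.
\<close>

definition conf_pull2 ::
  "('a::euclidean_space lorentz \<Rightarrow> 'a lorentz) \<Rightarrow> complex \<Rightarrow> complex \<Rightarrow> ('a \<times> 'a \<Rightarrow> complex) \<Rightarrow> 'a \<times> 'a \<Rightarrow> complex" where
  "conf_pull2 h s t f = (\<lambda>(y, z).
     of_real (conf_den h y) powr (- s) * of_real (conf_den h z) powr (- t) * f (act h y, act h z))"

definition conf_dom :: "('a::euclidean_space lorentz \<Rightarrow> 'a lorentz) \<Rightarrow> 'a set" where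
  "conf_dom h = {x. conf_den h x > 0}"

lemma smooth_lorentz_lightcone:
  assumes "lorentz_linear h" "open S" shows "smooth_on S (\<lambda>x. h (lightcone x))"
  by (rule smooth_on_linear_apply[OF assms(2) lorentz_linear_bounded[OF assms(1)] smooth_lightcone])

lemma smooth_conf_den:
  assumes "lorentz_linear h" "open S" shows "smooth_on S (conf_den h)"
  unfolding conf_den_def
  by (rule smooth_on_linear_apply[OF assms(2) linear_cone_height smooth_lorentz_lightcone[OF assms]])

lemma open_conf_dom: "lorentz_linear h \<Longrightarrow> open (conf_dom h)"
  unfolding conf_dom_def
  using smooth_on_continuous[OF smooth_conf_den[OF _ open_UNIV]] by (intro open_Collect_less) auto

lemma smooth_act:
  assumes h: "lorentz_linear h" shows "smooth_on (conf_dom h) (act h)"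
proof -
  have "smooth_on (conf_dom h) (\<lambda>x. cone_point (h (lightcone x)))"
    by (rule smooth_on_compose[OF open_conf_dom[OF h] open_cone_height
          smooth_lorentz_lightcone[OF h open_conf_dom[OF h]] _ smooth_cone_point])
      (auto simp: conf_dom_def conf_den_def)
  then show ?thesis by (simp add: act_eq_cone_point[OF h, abs_def])
qed

lemma smooth_conf_den_powr:
  assumes h: "lorentz_linear h"
  shows "smooth_on (conf_dom h) (\<lambda>x. complex_of_real (conf_den h x) powr s)"
  by (rule smooth_on_compose[OF open_conf_dom[OF h] _ smooth_conf_den[OF h open_conf_dom[OF h]]
        _ smooth_on_powr_pos]) (auto simp: conf_dom_def)

lemma smooth_conf_pull:
  assumes h: "lorentz_linear h" and u: "smooth u"
  shows "smooth_on (conf_dom h) (conf_pull h s u)"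
proof -
  have "smooth_on (conf_dom h) (\<lambda>x. u (act h x))"
    by (rule smooth_on_compose[OF open_conf_dom[OF h] open_UNIV smooth_act[OF h]])
      (use u in \<open>simp_all add: smooth_on_UNIV\<close>)
  from smooth_on_mult[OF open_conf_dom[OF h] smooth_conf_den_powr[OF h] this]
  show ?thesis unfolding conf_pull_def[abs_def] .
qed

lemma open_conf_dom2: "lorentz_linear h \<Longrightarrow> open (conf_dom h \<times> conf_dom h)"
  by (intro open_Times open_conf_dom)

lemma smooth_conf_pull2:
  fixes f :: "'a::euclidean_space \<times> 'a \<Rightarrow> complex"
  assumes h: "lorentz_linear h" and f: "smooth f"
  shows "smooth_on (conf_dom h \<times> conf_dom h) (conf_pull2 h s t f)"
proof -
  let ?W = "conf_dom h \<times> conf_dom h"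
  note W = open_conf_dom2[OF h]
  have fs: "smooth_on ?W fst" "smooth_on ?W snd"
    by (intro smooth_on_bounded_linear bounded_linear_fst bounded_linear_snd)+
  have ac: "smooth_on ?W (\<lambda>p. act h (fst p))" "smooth_on ?W (\<lambda>p. act h (snd p))"
    by (rule smooth_on_compose[OF W open_conf_dom[OF h] fs(1) _ smooth_act[OF h]], force)
      (rule smooth_on_compose[OF W open_conf_dom[OF h] fs(2) _ smooth_act[OF h]], force)
  have pw: "smooth_on ?W (\<lambda>p. complex_of_real (conf_den h (fst p)) powr (- s))"
    "smooth_on ?W (\<lambda>p. complex_of_real (conf_den h (snd p)) powr (- t))"
    by (rule smooth_on_compose[OF W open_conf_dom[OF h] fs(1) _ smooth_conf_den_powr[OF h]], force)
      (rule smooth_on_compose[OF W open_conf_dom[OF h] fs(2) _ smooth_conf_den_powr[OF h]], force)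
  have "smooth_on ?W (\<lambda>p. f (act h (fst p), act h (snd p)))"
    by (rule smooth_on_compose[OF W open_UNIV smooth_on_Pair[OF W ac]])
      (use f in \<open>simp_all add: smooth_on_UNIV\<close>)
  from smooth_on_mult[OF W smooth_on_mult[OF W pw] this]
  show ?thesis unfolding conf_pull2_def case_prod_beta .
qed

lemma smooth_slice:
  fixes f :: "'a::euclidean_space \<times> 'a \<Rightarrow> complex"
  assumes "smooth f" shows "smooth (\<lambda>y. f (y, z))" "smooth (\<lambda>z. f (y, z))"
  using smooth_on_slice[OF open_UNIV, of f] assms by (simp_all add: smooth_on_UNIV)

lemma smooth_tractor_D_slice:
  fixes f :: "'a::euclidean_space \<times> 'a \<Rightarrow> complex"
  assumes f: "smooth f"
  shows "smooth (\<lambda>y. tractor_D t N (\<lambda>z. f (y, z)) z)"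
proof -
  have f': "smooth_on UNIV f" using f by (simp add: smooth_on_UNIV)
  have "smooth_on UNIV (\<lambda>y. g (y, z))" if "smooth_on UNIV g" for g :: "'a \<times> 'a \<Rightarrow> complex"
    using smooth_on_slice(1)[OF open_UNIV that, of z] by simp
  note sl = this[OF f'] this[OF smooth_partial(2)[OF open_UNIV f']] this[OF smooth_partial(4)[OF open_UNIV f']]
  show ?thesis
    unfolding smooth_on_UNIV[symmetric] tractor_D_slice(2)[OF open_UNIV UNIV_I f']
    by (intro smooth_on_add smooth_on_mult smooth_on_sum smooth_on_const open_UNIV sl)
qed

text \<open>
  For fixed \<open>y\<close> the transform is a constant times a transform in \<open>z\<close>, so the one-variable covariance
  applies in \<open>z\<close>; what remains is, as a function of \<open>y\<close>, again a constant times a transform.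
\<close>

lemma tractor_pair_covariant:
  fixes f :: "'a::euclidean_space \<times> 'a \<Rightarrow> complex"
  assumes h: "lorentz_linear h" and f: "smooth f" and yz: "y \<in> conf_dom h" "z \<in> conf_dom h"
  shows "tractor_pair s t (conf_pull2 h s t f) (y, z) M N =
     of_real (conf_den h y) powr (- (s + 1)) * of_real (conf_den h z) powr (- (t + 1)) *
     tractor_pair s t f (act h y, act h z) (h M) (h N)"
proof -
  define K where "K = complex_of_real (conf_den h z) powr (- (t + 1))"
  define w where "w = (\<lambda>y. tractor_D t (h N) (\<lambda>z. f (y, z)) (act h z))"
  have w: "smooth w" unfolding w_def by (rule smooth_tractor_D_slice[OF f])
  have inner: "tractor_D t N (\<lambda>z. conf_pull2 h s t f (y, z)) z = K * conf_pull h s w y" for y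
  proof -
    have "tractor_D t N (\<lambda>z. conf_pull2 h s t f (y, z)) z
      = tractor_D t N (\<lambda>z. of_real (conf_den h y) powr (- s) * conf_pull h t (\<lambda>z. f (act h y, z)) z) z"
      by (simp add: conf_pull2_def conf_pull_def mult.assoc)
    also have "\<dots> = of_real (conf_den h y) powr (- s) * tractor_D t N (conf_pull h t (\<lambda>z. f (act h y, z))) z"
      by (rule tractor_D_cmult[OF open_conf_dom[OF h] yz(2) smooth_conf_pull[OF h smooth_slice(2)[OF f]]])
    also have "tractor_D t N (conf_pull h t (\<lambda>z. f (act h y, z))) z = K * w (act h y)"
      unfolding K_def w_def
      using yz(2) by (intro tractor_D_covariant[OF h smooth_slice(2)[OF f]]) (simp add: conf_dom_def)
    finally show ?thesis by (simp add: conf_pull_def)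
  qed
  have "tractor_pair s t (conf_pull2 h s t f) (y, z) M N = tractor_D s M (\<lambda>y. K * conf_pull h s w y) y"
    by (simp add: tractor_pair_def inner)
  also have "\<dots> = K * tractor_D s M (conf_pull h s w) y"
    by (rule tractor_D_cmult[OF open_conf_dom[OF h] yz(1) smooth_conf_pull[OF h w]])
  also have "tractor_D s M (conf_pull h s w) y
      = of_real (conf_den h y) powr (- (s + 1)) * tractor_D s (h M) w (act h y)"
    using yz(1) by (intro tractor_D_covariant[OF h w]) (simp add: conf_dom_def)
  finally show ?thesis by (simp add: tractor_pair_def K_def w_def mult_ac)
qed

lemma F_op_covariant:
  fixes f :: "'a::euclidean_space \<times> 'a \<Rightarrow> complex"
  assumes h: "lorentz_linear h" and f: "smooth f" and p: "p \<in> conf_dom h \<times> conf_dom h"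
  shows "F_op lam mu (conf_pull2 h (rho TYPE('a) + lam) (rho TYPE('a) + mu) f) p
     = conf_pull2 h (rho TYPE('a) + lam + 1) (rho TYPE('a) + mu + 1) (F_op lam mu f) p"
proof -
  define s where "s = rho TYPE('a) + lam"
  define t where "t = rho TYPE('a) + mu"
  obtain y z where yz: "p = (y, z)" by fastforce
  have f': "smooth_on UNIV f" using f by (simp add: smooth_on_UNIV)
  have "F_op lam mu (conf_pull2 h s t f) p = wave_trace (tractor_pair s t (conf_pull2 h s t f) p) / 2"
    unfolding s_def t_def by (rule F_op_eq_contraction[OF open_conf_dom2[OF h] p smooth_conf_pull2[OF h f]])
  also have "tractor_pair s t (conf_pull2 h s t f) p = (\<lambda>M N.
     of_real (conf_den h y) powr (- (s + 1)) * of_real (conf_den h z) powr (- (t + 1)) *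
     tractor_pair s t f (act h y, act h z) (h M) (h N))"
    unfolding yz using p by (intro ext tractor_pair_covariant[OF h f]) (auto simp: yz)
  also have "wave_trace \<dots> = of_real (conf_den h y) powr (- (s + 1)) * of_real (conf_den h z) powr (- (t + 1)) *
     wave_trace (tractor_pair s t f (act h y, act h z))"
    unfolding wave_trace_cmult wave_trace_invariant[OF bilinear_tractor_pair[OF open_UNIV UNIV_I f'] h] ..
  also have "\<dots> / 2 = of_real (conf_den h y) powr (- (s + 1)) * of_real (conf_den h z) powr (- (t + 1)) *
     F_op lam mu f (act h y, act h z)"
    unfolding F_op_eq_contraction[OF open_UNIV UNIV_I f'] s_def t_def by simp
  finally show ?thesis by (simp add: conf_pull2_def yz s_def t_def)
qed

lemma F_op_cong_open:
  fixes f g :: "'a::euclidean_space \<times> 'a \<Rightarrow> complex"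
  assumes W: "open W" and p: "p \<in> W" and eq: "\<And>q. q \<in> W \<Longrightarrow> f q = g q"
  shows "F_op lam mu f p = F_op lam mu g p"
proof -
  have dy: "d_y b u q = d_y b v q" if "\<And>q. q \<in> W \<Longrightarrow> u q = v q" "q \<in> W" for u v :: "'a \<times> 'a \<Rightarrow> complex" and b q
    unfolding d_y_def by (rule dir_deriv_cong_open[OF W that(2,1)])
  have dz: "d_z b u q = d_z b v q" if "\<And>q. q \<in> W \<Longrightarrow> u q = v q" "q \<in> W" for u v :: "'a \<times> 'a \<Rightarrow> complex" and b q
    unfolding d_z_def by (rule dir_deriv_cong_open[OF W that(2,1)])
  have ly: "laplace_y u q = laplace_y v q" if "\<And>q. q \<in> W \<Longrightarrow> u q = v q" "q \<in> W" for u v :: "'a \<times> 'a \<Rightarrow> complex" and q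
    unfolding laplace_y_def using dy[OF dy[OF that(1)]] that(2) by simp
  have lz: "laplace_z u q = laplace_z v q" if "\<And>q. q \<in> W \<Longrightarrow> u q = v q" "q \<in> W" for u v :: "'a \<times> 'a \<Rightarrow> complex" and q
    unfolding laplace_z_def using dz[OF dz[OF that(1)]] that(2) by simp
  obtain y z where yz: "p = (y, z)" by fastforce
  show ?thesis
    unfolding F_op_def yz prod.case
    using ly[OF lz[OF eq]] dz[OF ly[OF eq]] dy[OF lz[OF eq]] ly[OF eq] lz[OF eq] dy[OF dz[OF eq]] p
    unfolding yz by simp
qed

lemma F_comp_cong_open:
  assumes W: "open W" and eq: "\<And>q. q \<in> W \<Longrightarrow> f q = g q" and p: "p \<in> W"
  shows "F_comp lam mu k f p = F_comp lam mu k g p"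
  using p
proof (induction k arbitrary: p)
  case (Suc k)
  show ?case unfolding F_comp.simps by (rule F_op_cong_open[OF W Suc.prems Suc.IH])
qed (simp add: eq)

lemma F_op_pointwise:
  fixes f :: "'a::euclidean_space \<times> 'a \<Rightarrow> complex"
  shows "F_op lam mu f = (\<lambda>p.
      of_real ((fst p - snd p) \<bullet> (fst p - snd p)) * laplace_y (laplace_z f) p
    + 4 * (mu + 1) * (\<Sum>b\<in>Basis. of_real (snd p \<bullet> b - fst p \<bullet> b) * d_z b (laplace_y f) p)
    + 4 * (lam + 1) * (\<Sum>b\<in>Basis. of_real (fst p \<bullet> b - snd p \<bullet> b) * d_y b (laplace_z f) p)
    + 4 * (mu + 1) * (mu + rho TYPE('a)) * laplace_y f p
    + 4 * (lam + 1) * (lam + rho TYPE('a)) * laplace_z f p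
    - 8 * (lam + 1) * (mu + 1) * (\<Sum>b\<in>Basis. d_y b (d_z b f) p))"
  unfolding F_op_def by (rule ext) (simp add: case_prod_beta power2_norm_eq_inner)

lemma smooth_F_op:
  fixes f :: "'a::euclidean_space \<times> 'a \<Rightarrow> complex"
  assumes "smooth f" shows "smooth (F_op lam mu f)"
proof -
  have f: "smooth_on UNIV f" using assms by (simp add: smooth_on_UNIV)
  note sm = smooth_partial[OF open_UNIV]
  have fs: "smooth_on UNIV (fst :: 'a \<times> 'a \<Rightarrow> 'a)" "smooth_on UNIV (snd :: 'a \<times> 'a \<Rightarrow> 'a)"
    by (intro smooth_on_bounded_linear bounded_linear_fst bounded_linear_snd)+
  show ?thesis
    unfolding smooth_on_UNIV[symmetric] F_op_pointwise
    by (intro smooth_on_add smooth_on_diff smooth_on_mult smooth_on_sum smooth_on_const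
        smooth_on_of_real smooth_on_inner open_UNIV sm f fs)
qed

lemma smooth_F_comp: "smooth f \<Longrightarrow> smooth (F_comp lam mu k f)"
  by (induction k) (simp_all add: smooth_F_op)

lemma F_comp_covariant:
  fixes f :: "'a::euclidean_space \<times> 'a \<Rightarrow> complex"
  assumes h: "lorentz_linear h" and f: "smooth f" and p: "p \<in> conf_dom h \<times> conf_dom h"
  shows "F_comp lam mu k (conf_pull2 h (rho TYPE('a) + lam) (rho TYPE('a) + mu) f) p
     = conf_pull2 h (rho TYPE('a) + lam + of_nat k) (rho TYPE('a) + mu + of_nat k) (F_comp lam mu k f) p"
  using p
proof (induction k arbitrary: p)
  case (Suc k)
  have "F_comp lam mu (Suc k) (conf_pull2 h (rho TYPE('a) + lam) (rho TYPE('a) + mu) f) p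
    = F_op (lam + of_nat k) (mu + of_nat k)
       (conf_pull2 h (rho TYPE('a) + (lam + of_nat k)) (rho TYPE('a) + (mu + of_nat k)) (F_comp lam mu k f)) p"
    unfolding F_comp.simps
    by (rule F_op_cong_open[OF open_conf_dom2[OF h] Suc.prems]) (simp add: Suc.IH add.assoc)
  also have "\<dots> = conf_pull2 h (rho TYPE('a) + (lam + of_nat k) + 1) (rho TYPE('a) + (mu + of_nat k) + 1)
       (F_comp lam mu (Suc k) f) p"
    unfolding F_comp.simps by (rule F_op_covariant[OF h smooth_F_comp[OF f] Suc.prems])
  finally show ?case by (simp add: add_ac)
qed simp

section \<open>The conformal factor\<close>

text \<open>
  Differentiate \<open>h \<xi>(x) = c(x) \<xi>(h(x))\<close> in direction \<open>v\<close> and take Lorentz squares: the left side has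
  square \<open>-4|v|\<^sup>2\<close>, and on the right the term with the derivative of \<open>c\<close> is null and orthogonal to the
  other one, which has square \<open>-4c\<^sup>2|Dh(x)v|\<^sup>2\<close>.
\<close>

lemma norm_dir_deriv_act:
  assumes h: "lorentz_linear h" and x: "x \<in> conf_dom h"
  shows "conf_den h x * norm (dir_deriv v (act h) x) = norm v"
proof -
  define c where "c = conf_den h x"
  define D where "D = dir_deriv v (act h) x"
  define c' where "c' = dir_deriv v (conf_den h) x"
  have c: "c > 0" using x by (simp add: c_def conf_dom_def)
  note W = open_conf_dom[OF h]
  have da: "act h differentiable (at x)" by (rule smooth_on_differentiable[OF smooth_act[OF h] x])
  have dc: "conf_den h differentiable (at x)" by (rule smooth_on_differentiable[OF smooth_conf_den[OF h W] x])
  have dl: "(\<lambda>x. lightcone (act h x)) differentiable (at x)"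
    by (rule dir_deriv_compose(2)[OF da differentiable_lightcone])
  have "h (lightcone_deriv v x) = dir_deriv v (\<lambda>x. h (lightcone x)) x"
    unfolding dir_deriv_linear_apply[OF lorentz_linear_bounded[OF h] differentiable_lightcone] dir_deriv_lightcone ..
  also have "\<dots> = dir_deriv v (\<lambda>x. conf_den h x *\<^sub>R lightcone (act h x)) x"
    by (rule dir_deriv_cong_open[OF W x]) (simp add: conf_dom_def lorentz_lightcone_act[OF h])
  also have "\<dots> = c *\<^sub>R lightcone_deriv D (act h x) + c' *\<^sub>R lightcone (act h x)"
    unfolding dir_deriv_bilinear[OF bounded_bilinear_scaleR dc dl]
      dir_deriv_compose(1)[OF da differentiable_lightcone] dir_deriv_lightcone c_def c'_def D_def ..
  finally have e: "h (lightcone_deriv v x) = c *\<^sub>R lightcone_deriv D (act h x) + c' *\<^sub>R lightcone (act h x)" .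
  have "- 4 * (v \<bullet> v) = lform (h (lightcone_deriv v x)) (h (lightcone_deriv v x))"
    by (simp only: lorentz_linearD(3)[OF h] lform_lightcone_deriv2)
  also have "\<dots> = - 4 * (c * c * (D \<bullet> D))"
    unfolding e lform_simps lform_commute[of "lightcone (act h x)" "lightcone_deriv _ _"]
    by (simp add: lform_lightcone lform_lightcone_deriv lform_lightcone_deriv2)
  finally have "(norm v)\<^sup>2 = (c * norm D)\<^sup>2"
    unfolding power_mult_distrib power2_norm_eq_inner by (simp add: power2_eq_square)
  then have "norm v = c * norm D" using c by (simp add: power2_eq_iff_nonneg)
  then show ?thesis by (simp add: c_def D_def)
qed

lemma kappa_eq:
  fixes h :: "'a::euclidean_space lorentz \<Rightarrow> 'a lorentz"
  assumes h: "lorentz_linear h" and x: "x \<in> conf_dom h"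
  shows "kappa h x = inverse (conf_den h x)"
proof -
  have c: "conf_den h x > 0" using x by (simp add: conf_dom_def)
  have n: "norm (frechet_derivative (act h) (at x) v) = inverse (conf_den h x) * norm v" for v
    unfolding norm_dir_deriv_act[OF h x, of v, symmetric] using c by (simp add: dir_deriv_def)
  obtain b :: 'a where b: "b \<in> Basis" using nonempty_Basis by blast
  show ?thesis
    unfolding kappa_def
  proof (rule the_equality)
    show "inverse (conf_den h x) > 0 \<and>
        (\<forall>\<xi>. norm (frechet_derivative (act h) (at x) \<xi>) = inverse (conf_den h x) * norm \<xi>)"
      using c n by simp
    show "k = inverse (conf_den h x)"
      if "k > 0 \<and> (\<forall>\<xi>. norm (frechet_derivative (act h) (at x) \<xi>) = k * norm \<xi>)" for k
      using that n[of b] b by simp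
  qed
qed

lemma inverse_powr_pos: "c > 0 \<Longrightarrow> complex_of_real (inverse c) powr s = of_real c powr (- s)"
proof -
  assume c: "c > 0"
  have "(complex_of_real (inverse c) * of_real c) powr s = of_real (inverse c) powr s * of_real c powr s"
    using c by (intro powr_times_real) auto
  moreover have "complex_of_real (inverse c) * of_real c = 1" using c by simp
  ultimately have "of_real c powr s * complex_of_real (inverse c) powr s = 1"
    by (simp only: powr_one_eq_one mult.commute)
  then have "inverse (of_real c powr s) = complex_of_real (inverse c) powr s" by (rule inverse_unique)
  then show ?thesis by (simp only: powr_minus)
qed

section \<open>The Lorentz group near the identity\<close>

lemma lorentz_group_inverse:
  fixes g :: "'a::euclidean_space lorentz \<Rightarrow>\<^sub>L 'a lorentz"
  assumes g: "g \<in> lorentz_group"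
  shows "lorentz_linear (inv (blinfun_apply g))" "surj (blinfun_apply g)"
proof -
  have lin: "linear (blinfun_apply g)"
    using blinfun.bounded_linear_right bounded_linear.linear by blast
  have form: "lform (g v) (g w) = lform v w" for v w
  proof -
    have q: "lform (g u) (g u) = lform u u" for u
      using g unfolding lorentz_group_def lorentz_form_eq_lform by blast
    have "lform (g (v + w)) (g (v + w)) = lform (v + w) (v + w)" by (rule q)
    then show ?thesis
      unfolding linear_add[OF lin] lform_simps q[of v] q[of w]
      using lform_commute[of "g v" "g w"] lform_commute[of v w] by linarith
  qed
  have "inj (blinfun_apply g)"
  proof (rule linear_injective_0[OF lin, THEN iffD2], intro allI impI)
    fix v assume v: "g v = 0"
    show "v = 0"
    proof (rule lform_nondegenerate)
      fix u
      show "lform v u = lform 0 u"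
        using form[of v u] unfolding v by (simp add: lform_def)
    qed
  qed
  then have bij: "inj (blinfun_apply g)" "surj (blinfun_apply g)"
    using linear_inj_imp_surj[OF lin] by blast+
  then show "surj (blinfun_apply g)" by blast
  have gi: "g (inv (blinfun_apply g) v) = v" for v by (rule surj_f_inv_f[OF bij(2)])
  have ig: "inv (blinfun_apply g) (g v) = v" for v by (rule inv_f_f[OF bij(1)])
  have "linear (inv (blinfun_apply g))"
  proof (rule linearI)
    show "inv (blinfun_apply g) (v + w) = inv (blinfun_apply g) v + inv (blinfun_apply g) w" for v w
      using ig[of "inv (blinfun_apply g) v + inv (blinfun_apply g) w"] unfolding linear_add[OF lin] gi .
    show "inv (blinfun_apply g) (r *\<^sub>R v) = r *\<^sub>R inv (blinfun_apply g) v" for r v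
      using ig[of "r *\<^sub>R inv (blinfun_apply g) v"] unfolding linear_scale[OF lin] gi .
  qed
  moreover have "surj (inv (blinfun_apply g))" by (rule inj_imp_surj_inv[OF bij(1)])
  moreover have "lform (inv (blinfun_apply g) v) (inv (blinfun_apply g) w) = lform v w" for v w
    using form[of "inv (blinfun_apply g) v" "inv (blinfun_apply g) w"] unfolding gi by simp
  ultimately show "lorentz_linear (inv (blinfun_apply g))"
    unfolding lorentz_linear_def by blast
qed

lemma null_norm_snd: "lform X X = 0 \<Longrightarrow> norm (snd X) = \<bar>fst X\<bar>"
proof -
  assume "lform X X = 0"
  then have "(norm (snd X))\<^sup>2 = \<bar>fst X\<bar>\<^sup>2"
    unfolding power2_norm_eq_inner power2_abs by (simp add: lform_def power2_eq_square)
  then show ?thesis unfolding power2_eq_iff_nonneg[OF norm_ge_zero abs_ge_zero] .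
qed

text \<open>
  If \<open>Y = g\<^sup>-\<^sup>1 \<xi>(x)\<close> were not in the forward cone, then \<open>|Y| \<le> -2 Y\<^sub>0\<close> since \<open>Y\<close> is null, and \<open>g\<close> would move
  the time coordinate of \<open>Y\<close> by at most \<open>|Y|/2 \<le> -Y\<^sub>0\<close>; so \<open>\<xi>(x) = g Y\<close> would not be forward either. This
  is where the radius \<open>1/2\<close> comes from.
\<close>

lemma lorentz_near_identity_forward:
  fixes g :: "'a::euclidean_space lorentz \<Rightarrow>\<^sub>L 'a lorentz"
  assumes g: "g \<in> lorentz_group" and near: "norm (g - id_blinfun) < 1 / 2"
  shows "fst (inv (blinfun_apply g) (lightcone x)) > 0"
proof (rule ccontr)
  define Y where "Y = inv (blinfun_apply g) (lightcone x)"
  assume "\<not> fst (inv (blinfun_apply g) (lightcone x)) > 0"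
  then have neg: "fst Y \<le> 0" by (simp add: Y_def)
  have gY: "g Y = lightcone x" unfolding Y_def by (rule surj_f_inv_f[OF lorentz_group_inverse(2)[OF g]])
  have "lform Y Y = 0" unfolding Y_def by (rule lorentz_linear_null[OF lorentz_group_inverse(1)[OF g]])
  then have "norm (snd Y) = \<bar>fst Y\<bar>" by (rule null_norm_snd)
  then have nY: "norm Y \<le> 2 * \<bar>fst Y\<bar>"
    using norm_Pair_le[of "fst Y" "snd Y"] by simp
  have "fst (lightcone x) - fst Y \<le> norm (fst (g Y - Y))" unfolding gY by simp
  also have "\<dots> \<le> norm (g Y - Y)" by (metis norm_fst_le prod.collapse)
  also have "g Y - Y = (g - id_blinfun) Y" by (simp add: blinfun.diff_left)
  also have "norm ((g - id_blinfun) Y) \<le> norm (g - id_blinfun) * norm Y" by (rule norm_blinfun)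
  also have "\<dots> \<le> 1 / 2 * (2 * \<bar>fst Y\<bar>)"
    using near nY by (intro mult_mono) auto
  finally have "fst (lightcone x) \<le> 0" using neg by simp
  moreover have "fst (lightcone x) > 0" by (simp add: lightcone_def add_pos_nonneg)
  ultimately show False by simp
qed

lemma conf_den_nonneg:
  assumes h: "lorentz_linear h" and fw: "fst (h (lightcone x)) > 0"
  shows "conf_den h x \<ge> 0"
proof -
  have "\<bar>snd (snd (h (lightcone x)))\<bar> \<le> norm (snd (h (lightcone x)))"
    using norm_snd_le[of "snd (snd (h (lightcone x)))" "fst (snd (h (lightcone x)))"] by simp
  then show ?thesis
    using null_norm_snd[OF lorentz_linear_null[OF h, of x]] fw by (simp add: conf_den_def cone_height_def)
qed

section \<open>Differential operators\<close>

text \<open>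
  The condition that defines \<open>bidifferential_operator\<close>, before restriction to the diagonal. In this
  form it is stable under sums, products with smooth functions and derivatives.
\<close>

definition differential_operator :: "(('b::euclidean_space \<Rightarrow> complex) \<Rightarrow> 'b \<Rightarrow> complex) \<Rightarrow> bool" where
  "differential_operator D \<longleftrightarrow>
    (\<exists>S a. finite S \<and> S \<subseteq> lists Basis \<and> (\<forall>vs\<in>S. smooth (a vs)) \<and>
       (\<forall>f. smooth f \<longrightarrow> (\<forall>x. D f x = (\<Sum>vs\<in>S. a vs x * foldr dir_deriv vs f x))))"

lemma smooth_foldr_dir_deriv: "smooth f \<Longrightarrow> smooth (foldr dir_deriv vs f)"
  by (induction vs) (simp_all add: smooth_on_UNIV[symmetric] smooth_on_dir_deriv)

lemma differential_operator_ident: "differential_operator (\<lambda>f. f)"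
  unfolding differential_operator_def
proof (intro exI conjI)
  show "\<forall>vs\<in>{[]}. smooth (\<lambda>x :: 'a. 1 :: complex)" by (simp add: smooth_on_UNIV[symmetric])
qed auto

lemma differential_operator_add:
  assumes "differential_operator D" "differential_operator E"
  shows "differential_operator (\<lambda>f x. D f x + E f x)"
proof -
  obtain S a where S: "finite S" "S \<subseteq> lists Basis" "\<forall>vs\<in>S. smooth (a vs)"
    and D: "\<And>f x. smooth f \<Longrightarrow> D f x = (\<Sum>vs\<in>S. a vs x * foldr dir_deriv vs f x)"
    using assms(1) unfolding differential_operator_def by blast
  obtain T b where T: "finite T" "T \<subseteq> lists Basis" "\<forall>vs\<in>T. smooth (b vs)"
    and E: "\<And>f x. smooth f \<Longrightarrow> E f x = (\<Sum>vs\<in>T. b vs x * foldr dir_deriv vs f x)"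
    using assms(2) unfolding differential_operator_def by blast
  \<comment> \<open>A list may occur in only one of \<open>S\<close> and \<open>T\<close>; its other coefficient is \<open>0\<close>.\<close>
  define c where "c vs x = (if vs \<in> S then a vs x else 0) + (if vs \<in> T then b vs x else 0)" for vs x
  have "smooth (\<lambda>x. if vs \<in> S then a vs x else 0)" for vs
    using S(3) by (cases "vs \<in> S") (simp_all add: smooth_on_UNIV[symmetric])
  moreover have "smooth (\<lambda>x. if vs \<in> T then b vs x else 0)" for vs
    using T(3) by (cases "vs \<in> T") (simp_all add: smooth_on_UNIV[symmetric])
  ultimately have c: "smooth (c vs)" for vs
    unfolding c_def[abs_def] smooth_on_UNIV[symmetric] by (intro smooth_on_add open_UNIV)
  have "D f x + E f x = (\<Sum>vs\<in>S \<union> T. c vs x * foldr dir_deriv vs f x)" if f: "smooth f" for f x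
  proof -
    have "(\<Sum>vs\<in>S \<union> T. c vs x * foldr dir_deriv vs f x)
      = (\<Sum>vs\<in>S \<union> T. (if vs \<in> S then a vs x * foldr dir_deriv vs f x else 0))
      + (\<Sum>vs\<in>S \<union> T. (if vs \<in> T then b vs x * foldr dir_deriv vs f x else 0))"
      unfolding sum.distrib[symmetric] by (intro sum.cong refl) (simp add: c_def distrib_right)
    also have "(\<Sum>vs\<in>S \<union> T. (if vs \<in> S then a vs x * foldr dir_deriv vs f x else 0)) = D f x"
      unfolding D[OF f] using S(1) T(1) by (intro sum.mono_neutral_cong_right) auto
    also have "(\<Sum>vs\<in>S \<union> T. (if vs \<in> T then b vs x * foldr dir_deriv vs f x else 0)) = E f x"
      unfolding E[OF f] using S(1) T(1) by (intro sum.mono_neutral_cong_right) auto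
    finally show ?thesis ..
  qed
  then show ?thesis
    unfolding differential_operator_def using S T c
    by (intro exI[of _ "S \<union> T"] exI[of _ c]) auto
qed

lemma differential_operator_mult:
  assumes "differential_operator D" "smooth c"
  shows "differential_operator (\<lambda>f x. c x * D f x)"
proof -
  obtain S a where S: "finite S" "S \<subseteq> lists Basis" "\<forall>vs\<in>S. smooth (a vs)"
    and D: "\<And>f x. smooth f \<Longrightarrow> D f x = (\<Sum>vs\<in>S. a vs x * foldr dir_deriv vs f x)"
    using assms(1) unfolding differential_operator_def by blast
  have "\<forall>vs\<in>S. smooth (\<lambda>x. c x * a vs x)"
    using S(3) assms(2) smooth_on_mult[OF open_UNIV] by (auto simp: smooth_on_UNIV)
  then show ?thesis
    unfolding differential_operator_def using S(1,2) D
    by (intro exI[of _ S] exI[of _ "\<lambda>vs x. c x * a vs x"]) (auto simp: sum_distrib_left mult.assoc)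
qed

lemma differential_operator_cmult: "differential_operator D \<Longrightarrow> differential_operator (\<lambda>f x. c * D f x)"
  by (rule differential_operator_mult) (simp_all add: smooth_on_UNIV[symmetric])

lemma differential_operator_diff:
  "differential_operator D \<Longrightarrow> differential_operator E \<Longrightarrow> differential_operator (\<lambda>f x. D f x - E f x)"
  using differential_operator_add[OF _ differential_operator_cmult[of E "-1"]] by simp

lemma differential_operator_sum:
  assumes "finite I" "\<And>i. i \<in> I \<Longrightarrow> differential_operator (D i)"
  shows "differential_operator (\<lambda>f x. \<Sum>i\<in>I. D i f x)"
  using assms
proof (induction I)
  case empty
  then show ?case
    unfolding differential_operator_def by (intro exI[of _ "{}"]) auto
next
  case (insert i I)
  then show ?case using differential_operator_add[of "D i" "\<lambda>f x. \<Sum>i\<in>I. D i f x"] by simp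
qed

text \<open>
  By the product rule the derivative splits into \<open>D1\<close>, where the coefficients are differentiated, and
  \<open>D2\<close>, where \<open>b\<close> is put in front of every list of derivatives.
\<close>

lemma differential_operator_dir_deriv:
  fixes D :: "('b::euclidean_space \<Rightarrow> complex) \<Rightarrow> 'b \<Rightarrow> complex"
  assumes "differential_operator D" and b: "b \<in> Basis"
  shows "differential_operator (\<lambda>f. dir_deriv b (D f))"
proof -
  obtain S a where S: "finite S" "S \<subseteq> lists Basis" "\<forall>vs\<in>S. smooth (a vs)"
    and D: "\<And>f x. smooth f \<Longrightarrow> D f x = (\<Sum>vs\<in>S. a vs x * foldr dir_deriv vs f x)"
    using assms(1) unfolding differential_operator_def by blast
  define D1 where "D1 f x = (\<Sum>vs\<in>S. dir_deriv b (a vs) x * foldr dir_deriv vs f x)" for f x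
  define D2 where "D2 f x = (\<Sum>vs\<in>(#) b ` S. a (tl vs) x * foldr dir_deriv vs f x)" for f x
  have sub: "(#) b ` S \<subseteq> lists Basis"
    using b S(2) by (intro image_subsetI lists.Cons subsetD[OF S(2)])
  have "smooth (dir_deriv b (a vs))" if "vs \<in> S" for vs
    using S(3) that smooth_on_dir_deriv unfolding smooth_on_UNIV[symmetric] by blast
  then have "differential_operator D1"
    unfolding differential_operator_def D1_def
    using S(1,2) by (intro exI[of _ S] exI[of _ "\<lambda>vs. dir_deriv b (a vs)"]) auto
  moreover have "differential_operator D2"
    unfolding differential_operator_def D2_def
    using S(1,3) sub by (intro exI[of _ "(#) b ` S"] exI[of _ "\<lambda>vs. a (tl vs)"]) auto
  ultimately have D12: "differential_operator (\<lambda>f x. D1 f x + D2 f x)"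
    by (rule differential_operator_add)
  have "dir_deriv b (D f) x = D1 f x + D2 f x" if f: "smooth f" for f x
  proof -
    have da: "a vs differentiable (at x)" "foldr dir_deriv vs f differentiable (at x)" if "vs \<in> S" for vs
      by (rule smooth_on_differentiable[OF _ UNIV_I];
          use S(3) that smooth_foldr_dir_deriv[OF f] in \<open>simp add: smooth_on_UNIV\<close>)+
    have "dir_deriv b (\<lambda>x. \<Sum>vs\<in>S. a vs x * foldr dir_deriv vs f x) x
       = (\<Sum>vs\<in>S. a vs x * dir_deriv b (foldr dir_deriv vs f) x + dir_deriv b (a vs) x * foldr dir_deriv vs f x)"
      by (rule dir_derivI, rule has_derivative_sum)
        (intro has_derivative_mult has_derivative_dir_deriv da)
    also have "\<dots> = D1 f x + D2 f x"
      unfolding D1_def D2_def by (subst sum.reindex) (auto simp: sum.distrib inj_on_def)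
    also have "(\<lambda>x. \<Sum>vs\<in>S. a vs x * foldr dir_deriv vs f x) = D f" using D[OF f] by auto
    finally show ?thesis .
  qed
  then show ?thesis using D12 unfolding differential_operator_def by simp
qed

lemma differential_operator_F_op:
  fixes D :: "('a::euclidean_space \<times> 'a \<Rightarrow> complex) \<Rightarrow> 'a \<times> 'a \<Rightarrow> complex"
  assumes D: "differential_operator D"
  shows "differential_operator (\<lambda>f. F_op lam mu (D f))"
proof -
  have dy: "differential_operator (\<lambda>f. d_y b (E f))" if "b \<in> Basis" "differential_operator E"
    for b and E :: "('a \<times> 'a \<Rightarrow> complex) \<Rightarrow> 'a \<times> 'a \<Rightarrow> complex"
    unfolding d_y_def using that by (intro differential_operator_dir_deriv) (auto simp: Basis_prod_def)
  have dz: "differential_operator (\<lambda>f. d_z b (E f))" if "b \<in> Basis" "differential_operator E"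
    for b and E :: "('a \<times> 'a \<Rightarrow> complex) \<Rightarrow> 'a \<times> 'a \<Rightarrow> complex"
    unfolding d_z_def using that by (intro differential_operator_dir_deriv) (auto simp: Basis_prod_def)
  have ly: "differential_operator (\<lambda>f. laplace_y (E f))" if "differential_operator E"
    for E :: "('a \<times> 'a \<Rightarrow> complex) \<Rightarrow> 'a \<times> 'a \<Rightarrow> complex"
    unfolding laplace_y_def using that by (intro differential_operator_sum dy) auto
  have lz: "differential_operator (\<lambda>f. laplace_z (E f))" if "differential_operator E"
    for E :: "('a \<times> 'a \<Rightarrow> complex) \<Rightarrow> 'a \<times> 'a \<Rightarrow> complex"
    unfolding laplace_z_def using that by (intro differential_operator_sum dz) auto
  have fs: "smooth_on UNIV (fst :: 'a \<times> 'a \<Rightarrow> 'a)" "smooth_on UNIV (snd :: 'a \<times> 'a \<Rightarrow> 'a)"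
    by (intro smooth_on_bounded_linear bounded_linear_fst bounded_linear_snd)+
  have c: "smooth (\<lambda>p :: 'a \<times> 'a. complex_of_real ((fst p - snd p) \<bullet> (fst p - snd p)))"
    "smooth (\<lambda>p :: 'a \<times> 'a. complex_of_real (snd p \<bullet> b - fst p \<bullet> b))"
    "smooth (\<lambda>p :: 'a \<times> 'a. complex_of_real (fst p \<bullet> b - snd p \<bullet> b))" for b :: 'a
    unfolding smooth_on_UNIV[symmetric]
    by (intro smooth_on_diff smooth_on_const smooth_on_of_real smooth_on_inner open_UNIV fs)+
  show ?thesis
    unfolding F_op_pointwise
    by (intro differential_operator_add differential_operator_diff differential_operator_cmult
        differential_operator_sum differential_operator_mult[OF _ c(1)] differential_operator_mult[OF _ c(2)]
        differential_operator_mult[OF _ c(3)] dy dz ly lz D finite_Basis)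
qed

lemma differential_operator_F_comp: "differential_operator (F_comp lam mu k)"
proof (induction k)
  case 0
  have "F_comp lam mu 0 = (\<lambda>f :: 'a \<times> 'a \<Rightarrow> complex. f)" by auto
  then show ?case by (simp add: differential_operator_ident)
next
  case (Suc k)
  have "F_comp lam mu (Suc k) = (\<lambda>f :: 'a \<times> 'a \<Rightarrow> complex. F_op (lam + of_nat k) (mu + of_nat k) (F_comp lam mu k f))"
    by auto
  then show ?case by (simp add: differential_operator_F_op[OF Suc])
qed

lemma bidifferential_F_bidiff:
  "bidifferential_operator (F_bidiff lam mu k :: ('a::euclidean_space \<times> 'a \<Rightarrow> complex) \<Rightarrow> 'a \<Rightarrow> complex)"
proof -
  obtain S and a :: "('a \<times> 'a) list \<Rightarrow> 'a \<times> 'a \<Rightarrow> complex" where S: "finite S" "S \<subseteq> lists Basis" "\<forall>vs\<in>S. smooth (a vs)"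
    and D: "\<And>f x. smooth f \<Longrightarrow> F_comp lam mu k f x = (\<Sum>vs\<in>S. a vs x * foldr dir_deriv vs f x)"
    using differential_operator_F_comp[of lam mu k, where 'a = 'a] unfolding differential_operator_def by blast
  have "smooth (\<lambda>x. a vs (x, x))" if "vs \<in> S" for vs
  proof -
    have "smooth_on UNIV (\<lambda>x::'a. (x, x))"
      by (intro smooth_on_Pair smooth_on_ident open_UNIV)
    from smooth_on_compose[OF open_UNIV open_UNIV this subset_UNIV, of "a vs"] S(3) that
    show ?thesis by (simp add: smooth_on_UNIV)
  qed
  then show ?thesis
    unfolding bidifferential_operator_def F_bidiff_def using S(1,2) D
    by (intro exI[of _ S] exI[of _ "\<lambda>vs x. a vs (x, x)"]) (auto simp: test_functions_def)
qed

section \<open>Covariance of the bidifferential operators\<close>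

lemma F_op_zero: "F_op lam mu (\<lambda>p. 0) = (\<lambda>p. 0)"
  by (rule ext) (simp add: F_op_def laplace_y_def laplace_z_def d_y_def d_z_def split: prod.split)

lemma F_comp_zero: "F_comp lam mu k (\<lambda>p. 0) = (\<lambda>p. 0)"
  by (induction k) (simp_all add: F_op_zero)

lemma test_function_bounded_support:
  fixes f :: "'a::euclidean_space \<times> 'a \<Rightarrow> complex"
  assumes "f \<in> test_functions"
  obtains R where "R > 0" "\<And>y z. f (y, z) \<noteq> 0 \<Longrightarrow> norm y \<le> R \<and> norm z \<le> R"
proof -
  have "bounded (closure {x. f x \<noteq> 0})"
    using assms compact_imp_bounded by (auto simp: test_functions_def)
  then have "bounded {x. f x \<noteq> 0}" using bounded_subset closure_subset by metis
  then obtain R where R: "R > 0" "\<And>x. f x \<noteq> 0 \<Longrightarrow> norm x \<le> R" unfolding bounded_pos by blast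
  show ?thesis
  proof (rule that[OF R(1)])
    fix y z assume "f (y, z) \<noteq> 0"
    then have "norm (y, z) \<le> R" by (rule R(2))
    then show "norm y \<le> R \<and> norm z \<le> R"
      using norm_fst_le[of y z] norm_snd_le[of z y] by auto
  qed
qed

lemma pi_tensor_eq_conf_pull2:
  fixes f :: "'a::euclidean_space \<times> 'a \<Rightarrow> complex"
  assumes h: "lorentz_linear (inv (blinfun_apply g))" and p: "p \<in> conf_dom (inv (blinfun_apply g)) \<times> conf_dom (inv (blinfun_apply g))"
  shows "pi_tensor lam mu g f p
    = conf_pull2 (inv (blinfun_apply g)) (rho TYPE('a) + lam) (rho TYPE('a) + mu) f p"
proof -
  obtain y z where yz: "p = (y, z)" by fastforce
  define h where "h = inv (blinfun_apply g)"
  have y: "y \<in> conf_dom h" "z \<in> conf_dom h" using p by (auto simp: yz h_def)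
  then have c: "conf_den h y > 0" "conf_den h z > 0" by (auto simp: conf_dom_def)
  note hh = h[folded h_def]
  show ?thesis
    unfolding pi_tensor_def Let_def h_def[symmetric] yz prod.case conf_pull2_def
      kappa_eq[OF hh y(1)] kappa_eq[OF hh y(2)] inverse_powr_pos[OF c(1)] inverse_powr_pos[OF c(2)]
    using c by (simp add: act_defined_iff[OF hh])
qed

text \<open>
  Let \<open>f\<close> vanish off \<open>|y|, |z| \<le> R\<close>. If \<open>|h(y)| \<le> R\<close>, then the time coordinate \<open>c(y)(1 + |h(y)|\<^sup>2)\<close> of
  \<open>h \<xi>(y)\<close> is at most \<open>(1 + R\<^sup>2) c(y)\<close>. At a zero of \<open>c\<close> this inequality fails strictly, because the time
  coordinate is positive, and so it fails on a whole neighbourhood.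
\<close>

lemma pi_tensor_vanishes_at_singularity:
  fixes f :: "'a::euclidean_space \<times> 'a \<Rightarrow> complex"
  assumes f: "f \<in> test_functions" and h: "lorentz_linear (inv (blinfun_apply g))"
    and fw: "\<And>x. fst (inv (blinfun_apply g) (lightcone x)) > 0"
    and x: "conf_den (inv (blinfun_apply g)) x = 0"
  obtains W where "open W" "(x, x) \<in> W" "\<And>q. q \<in> W \<Longrightarrow> pi_tensor lam mu g f q = 0"
proof -
  define h where "h = inv (blinfun_apply g)"
  note hh = h[folded h_def]
  obtain R where R: "R > 0" "\<And>y z. f (y, z) \<noteq> 0 \<Longrightarrow> norm y \<le> R \<and> norm z \<le> R"
    using test_function_bounded_support[OF f] by blast
  define gap where "gap y = (R\<^sup>2 + 1) * conf_den h y - fst (h (lightcone y))" for y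
  let ?W = "{y. gap y < 0} \<times> (UNIV :: 'a set)"
  have "continuous_on UNIV (\<lambda>y. conf_den h y)" "continuous_on UNIV (\<lambda>y. h (lightcone y))"
    using smooth_on_continuous smooth_conf_den[OF hh open_UNIV] smooth_lorentz_lightcone[OF hh open_UNIV] by blast+
  then have "continuous_on UNIV gap" unfolding gap_def by (intro continuous_intros)
  then have "open {y. gap y < 0}" by (intro open_Collect_less) auto
  then have W: "open ?W" by (intro open_Times) auto
  have "gap x < 0" using x fw[of x] by (simp add: gap_def h_def)
  then have xW: "(x, x) \<in> ?W" by simp
  have "pi_tensor lam mu g f q = 0" if q: "q \<in> ?W" for q
  proof (rule ccontr)
    obtain y z where yz: "q = (y, z)" by fastforce
    assume "pi_tensor lam mu g f q \<noteq> 0"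
    then have def: "act_defined h y" and nz: "f (act h y, act h z) \<noteq> 0"
      unfolding pi_tensor_def Let_def h_def[symmetric] yz by (auto split: if_splits)
    have nn: "norm (act h y) \<le> R" using R(2)[OF nz] by simp
    have c: "conf_den h y > 0"
      using def conf_den_nonneg[OF hh, of y] fw[of y] act_defined_iff[OF hh, of y] by (simp add: h_def)
    have "fst (h (lightcone y)) = conf_den h y * (1 + (norm (act h y))\<^sup>2)"
      using lorentz_lightcone_act[OF hh, of y] c by (simp add: lightcone_def)
    also have "\<dots> \<le> conf_den h y * (1 + R\<^sup>2)"
      using c nn by (intro mult_left_mono add_left_mono power_mono) auto
    finally have "gap y \<ge> 0" by (simp add: gap_def algebra_simps)
    then show False using q by (simp add: yz)
  qed
  then show ?thesis using that W xW by blast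
qed

theorem theorem5p2:
  fixes lam mu :: complex and k :: nat
  assumes "DIM('a::euclidean_space) \<ge> 2"
  shows "covariant_bidifferential lam mu (lam + mu + rho TYPE('a) + 2 * of_nat k)
           (F_bidiff lam mu k :: ('a \<times> 'a \<Rightarrow> complex) \<Rightarrow> 'a \<Rightarrow> complex)"
  unfolding covariant_bidifferential_def
proof (intro conjI ballI)
  show "bidifferential_operator (F_bidiff lam mu k :: ('a \<times> 'a \<Rightarrow> complex) \<Rightarrow> 'a \<Rightarrow> complex)"
    by (rule bidifferential_F_bidiff)
  fix f :: "'a \<times> 'a \<Rightarrow> complex" assume f: "f \<in> test_functions"
  then have sm: "smooth f" by (simp add: test_functions_def)
  define r where "r = rho TYPE('a)"
  have "F_bidiff lam mu k (pi_tensor lam mu g f)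
      = pi_rep (lam + mu + rho TYPE('a) + 2 * of_nat k) g (F_bidiff lam mu k f)"
    if g: "g \<in> conformal_group \<inter> ball id_blinfun (1 / 2)" for g :: "'a lorentz \<Rightarrow>\<^sub>L 'a lorentz"
  proof (rule ext)
    fix x
    have gl: "g \<in> lorentz_group"
      using g connected_component_subset unfolding conformal_group_def by blast
    have near: "norm (g - id_blinfun) < 1 / 2"
      using g by (simp add: dist_norm norm_minus_commute)
    define h where "h = inv (blinfun_apply g)"
    have h: "lorentz_linear h" unfolding h_def by (rule lorentz_group_inverse(1)[OF gl])
    have fw: "fst (h (lightcone y)) > 0" for y
      unfolding h_def by (rule lorentz_near_identity_forward[OF gl near])
    show "F_bidiff lam mu k (pi_tensor lam mu g f) x
      = pi_rep (lam + mu + rho TYPE('a) + 2 * of_nat k) g (F_bidiff lam mu k f) x"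
    proof (cases "conf_den h x = 0")
      case True
      obtain W where W: "open W" "(x, x) \<in> W" "\<And>q. q \<in> W \<Longrightarrow> pi_tensor lam mu g f q = 0"
        using pi_tensor_vanishes_at_singularity[OF f h[unfolded h_def] fw[unfolded h_def] True[unfolded h_def]]
        by blast
      have "F_comp lam mu k (pi_tensor lam mu g f) (x, x) = F_comp lam mu k (\<lambda>p. 0) (x, x)"
        by (rule F_comp_cong_open[OF W(1) W(3) W(2)])
      then show ?thesis
        using True act_defined_iff[OF h, of x]
        by (simp add: F_bidiff_def F_comp_zero pi_rep_def h_def[symmetric])
    next
      case False
      then have c: "conf_den h x > 0" using conf_den_nonneg[OF h fw, of x] by simp
      then have x: "x \<in> conf_dom h" by (simp add: conf_dom_def)
      have "F_bidiff lam mu k (pi_tensor lam mu g f) x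
         = F_comp lam mu k (conf_pull2 h (r + lam) (r + mu) f) (x, x)"
        unfolding F_bidiff_def h_def r_def
        by (rule F_comp_cong_open[OF open_conf_dom2[OF h[unfolded h_def]]
              pi_tensor_eq_conf_pull2[OF h[unfolded h_def]]])
          (use x in \<open>simp_all add: h_def\<close>)
      also have "\<dots> = conf_pull2 h (r + lam + of_nat k) (r + mu + of_nat k) (F_comp lam mu k f) (x, x)"
        unfolding r_def using x by (intro F_comp_covariant[OF h sm]) simp
      also have "\<dots> = of_real (conf_den h x) powr (- (r + (lam + mu + r + 2 * of_nat k)))
          * F_bidiff lam mu k f (act h x)"
      proof -
        have e: "- (r + lam + of_nat k) + - (r + mu + of_nat k) = - (r + (lam + mu + r + 2 * of_nat k))"
          by (simp add: algebra_simps)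
        show ?thesis
          unfolding conf_pull2_def prod.case F_bidiff_def powr_add[symmetric] e ..
      qed
      also have "\<dots> = pi_rep (lam + mu + rho TYPE('a) + 2 * of_nat k) g (F_bidiff lam mu k f) x"
        unfolding pi_rep_def Let_def h_def[symmetric] kappa_eq[OF h x] inverse_powr_pos[OF c] r_def
        using False by (simp add: act_defined_iff[OF h])
      finally show ?thesis .
    qed
  qed
  then show "\<exists>U. open U \<and> id_blinfun \<in> U \<and> (\<forall>g\<in>conformal_group \<inter> U.
      F_bidiff lam mu k (pi_tensor lam mu g f)
      = pi_rep (lam + mu + rho TYPE('a) + 2 * of_nat k) g (F_bidiff lam mu k f))"
    by (intro exI[of _ "ball id_blinfun (1 / 2)"]) auto
qed

end
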